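(* Let $n\ge1$ and let $w$ be a Kreweras word of length $3n$ with trip permutation $\sigma_w$. Then \[\mathrm{evac}(w)=(w_{\sigma_w(3n)},w_{\sigma_w(3n-1)},\dots,w_{\sigma_w(1)}).\]
   Context: A Kreweras word of length $3n$ is a word $w=(w_1,\dots,w_{3n})$ in letters $\mathsf A,\mathsf B,\mathsf C$ with exactly $n$ of each letter such that every prefix has at least as many $\mathsf A$'s as $\mathsf B$'s and at least as many $\mathsf A$'s as $\mathsf C$'s. For $1\le i\le 3n-1$ let $\tau_i(w)$ be the word obtained by swapping $w_i$ and $w_{i+1}$ if the result is a Kreweras word, and $\tau_i(w)=w$ otherwise. Evacuation is $\mathrm{evac}=(\tau_1)\circ(\tau_2\circ\tau_1)\circ\cdots\circ(\tau_{3n-1}\circ\cdots\circ\tau_2\circ\tau_1)$ (maps applied right to left). Trip permutation: for $\varepsilon\in\{\mathsf B,\mathsf C\}$ let $M^\varepsilon_w$ be the unique noncrossing perfect matching of $\{i:w_i\in\{\mathsf A,\varepsilon\}\}$ by arcs $(i,j)$, $i<j$, with $w_i=\mathsf A$, $w_j=\varepsilon$ (noncrossing: no arcs $(i,j),(k,l)$ with $i<k<j<l$). Arcs $(a,b),(c,d)$ of $M^{\mathsf B}_w\cup M^{\mathsf C}_w$ cross if $a\le c<b<d$. Draw $1,\dots,3n$ in order on a horizontal line and each arc as a curve in the upper half plane joining its endpoints so that two arcs meet iff they cross, exactly once (arcs $(a,b),(a,d)$ meet at the point $a$). For $i\in\{1,\dots,3n\}$, take a walk starting at $i$: if $w_i\neq\mathsf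 A$, start along the unique arc containing $i$; if $w_i=\mathsf A$, start along the arc $(i,i')$ containing $i$ with the smaller $i'$. Whenever the walk reaches the meeting point of crossing arcs $(a,b),(c,d)$ with $a\le c<b<d$, it continues towards $b$ if it came from the direction of $a$, towards $a$ if it came from $c$, towards $d$ if it came from $b$, and towards $c$ if it came from $d$. The walk stops when it reaches a point $j\in\{1,\dots,3n\}$ where these rules do not send it on (in particular, arriving at $a$ along $(a,b)$ from $b$, where $(a,b),(a,d)$ with $b<d$ are the arcs at $a$, it continues along $(a,d)$ towards $d$; arriving at $a$ from $d$ it stops). Set $\sigma_w(i)=j$. Then $\sigma_w$ is a permutation of $\{1,\dots,3n\}$. *)

theory Defs
  imports Complex_Main
begin

datatype letter = A | B | C

text \<open>Positions in a word are numbered from 1.\<close>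

definition letter_at :: "letter list \<Rightarrow> nat \<Rightarrow> letter" where
  "letter_at w i = w ! (i - 1)"

definition kreweras :: "nat \<Rightarrow> letter list \<Rightarrow> bool" where
  "kreweras n w \<longleftrightarrow> length w = 3 * n \<and> (\<forall>x. count_list w x = n) \<and>
     (\<forall>k \<le> length w. count_list (take k w) B \<le> count_list (take k w) A \<and>
                     count_list (take k w) C \<le> count_list (take k w) A)"

definition swap :: "nat \<Rightarrow> letter list \<Rightarrow> letter list" where
  "swap i w = w[i - 1 := letter_at w (Suc i), i := letter_at w i]"

definition tau :: "nat \<Rightarrow> nat \<Rightarrow> letter list \<Rightarrow> letter list" where
  "tau n i w = (if kreweras n (swap i w) then swap i w else w)"

text \<open>\<open>partial_prom n k\<close> is \<open>\<tau>\<^sub>k \<circ> \<dots> \<circ> \<tau>\<^sub>2 \<circ> \<tau>\<^sub>1\<close>; since \<^const>\<open>foldr\<close> applies its function to the last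
  list entry first, \<open>evac n\<close> is
  \<open>partial_prom n 1 \<circ> partial_prom n 2 \<circ> \<dots> \<circ> partial_prom n (3 * n - 1)\<close>.\<close>

definition partial_prom :: "nat \<Rightarrow> nat \<Rightarrow> letter list \<Rightarrow> letter list" where
  "partial_prom n k w = fold (tau n) [1..<Suc k] w"

definition evac :: "nat \<Rightarrow> letter list \<Rightarrow> letter list" where
  "evac n w = foldr (partial_prom n) [1..<3 * n] w"

type_synonym arc = "nat \<times> nat"

definition noncrossing_matching :: "letter list \<Rightarrow> letter \<Rightarrow> arc set \<Rightarrow> bool" where
  "noncrossing_matching w \<epsilon> M \<longleftrightarrow>
     (\<forall>(i, j) \<in> M. 1 \<le> i \<and> i < j \<and> j \<le> length w \<and> letter_at w i = A \<and> letter_at w j = \<epsilon>) \<and>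
     (\<forall>k \<in> {1..length w}. letter_at w k \<in> {A, \<epsilon>} \<longrightarrow> (\<exists>!e. e \<in> M \<and> (fst e = k \<or> snd e = k))) \<and>
     (\<forall>(i, j) \<in> M. \<forall>(k, l) \<in> M. \<not> (i < k \<and> k < j \<and> j < l))"

definition kmatching :: "letter list \<Rightarrow> letter \<Rightarrow> arc set" where
  "kmatching w \<epsilon> = (THE M. noncrossing_matching w \<epsilon> M)"

definition arcs :: "letter list \<Rightarrow> arc set" where
  "arcs w = kmatching w B \<union> kmatching w C"

definition crosses :: "arc \<Rightarrow> arc \<Rightarrow> bool" where
  "crosses e f \<longleftrightarrow> fst e \<le> fst f \<and> fst f < snd e \<and> snd e < snd f"

text \<open>Every arc is drawn as the semicircle in the closed upper half plane over its two endpoints.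
  By \<open>semicircles_meet_iff\<close>, \<open>semicircles_meet_once\<close> and \<open>semicircles_meet_left\<close> this is an
  admissible drawing: semicircles of arcs sharing at most their left endpoints meet iff the arcs
  cross, and then in exactly one point; arcs with a common left endpoint meet at that endpoint. The real part is strictly increasing along each
  semicircle from its left to its right endpoint, so it orders the points of a curve.\<close>

definition semicircle :: "arc \<Rightarrow> complex set" where
  "semicircle e = {z. 0 \<le> Im z \<and>
     cmod (z - of_real ((real (fst e) + real (snd e)) / 2)) = (real (snd e) - real (fst e)) / 2}"

lemma semicircle_iff:
  assumes "a < b"
  shows "z \<in> semicircle (a, b) \<longleftrightarrow> 0 \<le> Im z \<and> (Im z)\<^sup>2 = (Re z - real a) * (real b - Re z)"
proof -
  have "cmod (z - of_real ((real a + real b) / 2)) = (real b - real a) / 2 \<longleftrightarrow>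
        (cmod (z - of_real ((real a + real b) / 2)))\<^sup>2 = ((real b - real a) / 2)\<^sup>2"
    using assms by (simp add: power2_eq_iff_nonneg)
  also have "\<dots> \<longleftrightarrow> (Im z)\<^sup>2 = (Re z - real a) * (real b - Re z)"
    unfolding cmod_power2 by (simp add: power2_eq_square field_simps) argo
  finally show ?thesis by (simp add: semicircle_def)
qed

lemma semicircle_Re_bounds:
  assumes "a < b" "z \<in> semicircle (a, b)"
  shows "real a \<le> Re z" "Re z \<le> real b"
proof -
  have "0 \<le> (Re z - real a) * (real b - Re z)"
    using assms semicircle_iff by (metis zero_le_power2)
  then show "real a \<le> Re z" "Re z \<le> real b"
    using assms(1) by (auto simp: zero_le_mult_iff)
qed

lemma semicircles_cross:
  assumes "crosses (a, b) (c, d)"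
  shows "\<exists>!z. z \<in> semicircle (a, b) \<inter> semicircle (c, d)"
proof -
  have ord: "a \<le> c" "c < b" "b < d" using assms by (auto simp: crosses_def)
  define D where "D = (real c - real a) + (real d - real b)"
  define x where "x = (real c * real d - real a * real b) / D"
  have D: "D > 0" using ord by (simp add: D_def)
  have eq_iff: "(t - real a) * (real b - t) = (t - real c) * (real d - t) \<longleftrightarrow> t = x" for t
  proof -
    have "t = x \<longleftrightarrow> t * D = real c * real d - real a * real b"
      using D by (simp add: x_def field_simps)
    also have "\<dots> \<longleftrightarrow> (t - real a) * (real b - t) = (t - real c) * (real d - t)"
      by (auto simp: D_def algebra_simps)
    finally show ?thesis by simp
  qed
  have "x - real c = (real c - real a) * (real b - real c) / D"
    using D by (simp add: x_def D_def field_simps)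
  moreover have "real d - x = (real d - real a) * (real d - real b) / D"
    using D by (simp add: x_def D_def field_simps)
  ultimately have nonneg: "0 \<le> (x - real c) * (real d - x)"
    using ord D by simp
  define y where "y = sqrt ((x - real c) * (real d - x))"
  have y: "0 \<le> y" "y\<^sup>2 = (x - real c) * (real d - x)" using nonneg by (auto simp: y_def)
  have mem: "z \<in> semicircle (a, b) \<inter> semicircle (c, d) \<longleftrightarrow>
      0 \<le> Im z \<and> Re z = x \<and> (Im z)\<^sup>2 = (x - real c) * (real d - x)" for z
    using ord semicircle_iff[of a b z] semicircle_iff[of c d z] eq_iff[of "Re z"] eq_iff[of x]
    by auto
  show ?thesis
  proof (rule ex1I[of _ "Complex x y"])
    show "Complex x y \<in> semicircle (a, b) \<inter> semicircle (c, d)"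
      unfolding mem using y by simp
    fix z assume "z \<in> semicircle (a, b) \<inter> semicircle (c, d)"
    then have z: "0 \<le> Im z" "Re z = x" "(Im z)\<^sup>2 = y\<^sup>2" unfolding mem using y by auto
    then have "Im z = y" using y(1) by (simp add: power2_eq_iff_nonneg)
    then show "z = Complex x y" using z(2) by (simp add: complex_eq_iff)
  qed
qed

lemma semicircles_nested:
  assumes "a < c" "c < d" "d < b"
  shows "semicircle (a, b) \<inter> semicircle (c, d) = {}"
proof (rule ccontr)
  assume "semicircle (a, b) \<inter> semicircle (c, d) \<noteq> {}"
  then obtain z where z: "z \<in> semicircle (a, b)" "z \<in> semicircle (c, d)" by blast
  have "real c \<le> Re z" "Re z \<le> real d" using semicircle_Re_bounds assms z by auto
  then have "(Re z - real c) * (real d - Re z) < (Re z - real a) * (real b - Re z)"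
    using assms by (intro mult_strict_mono') auto
  moreover have "a < b" using assms by simp
  ultimately show False using z assms by (simp add: semicircle_iff)
qed

lemma semicircles_disjoint:
  assumes "a < b" "b < c" "c < d"
  shows "semicircle (a, b) \<inter> semicircle (c, d) = {}"
proof (rule ccontr)
  assume "semicircle (a, b) \<inter> semicircle (c, d) \<noteq> {}"
  then obtain z where z: "z \<in> semicircle (a, b)" "z \<in> semicircle (c, d)" by blast
  have "real c \<le> Re z" "Re z \<le> real b" using semicircle_Re_bounds assms z by auto
  then show False using assms by simp
qed

lemma semicircles_meet_once:
  assumes "crosses e f \<or> crosses f e"
  shows "\<exists>!z. z \<in> semicircle e \<inter> semicircle f"
  using assms semicircles_cross[of "fst e" "snd e" "fst f" "snd f"]
    semicircles_cross[of "fst f" "snd f" "fst e" "snd e"]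
  by (auto simp: Int_commute)

lemma semicircles_meet_iff:
  assumes "fst e < snd e" "fst f < snd f"
    and "snd e \<noteq> snd f" "snd e \<noteq> fst f" "snd f \<noteq> fst e"
  shows "semicircle e \<inter> semicircle f \<noteq> {} \<longleftrightarrow> crosses e f \<or> crosses f e"
proof
  assume "crosses e f \<or> crosses f e"
  then show "semicircle e \<inter> semicircle f \<noteq> {}" using semicircles_meet_once by blast
next
  assume ne: "semicircle e \<inter> semicircle f \<noteq> {}"
  obtain a b c d where ef: "e = (a, b)" "f = (c, d)" by (cases e; cases f)
  show "crosses e f \<or> crosses f e"
  proof (rule ccontr)
    assume "\<not> (crosses e f \<or> crosses f e)"
    then have "a < c \<and> d < b \<or> c < a \<and> b < d \<or> b < c \<or> d < a"
      using assms by (auto simp: crosses_def ef)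
    then show False
      using ne assms semicircles_nested[of a c d b] semicircles_nested[of c a b d]
        semicircles_disjoint[of a b c d] semicircles_disjoint[of c d a b]
      by (auto simp: ef Int_commute)
  qed
qed

lemma semicircles_meet_left:
  assumes "a < b" "a < d" "b \<noteq> d"
  shows "semicircle (a, b) \<inter> semicircle (a, d) = {of_nat a}"
proof -
  have "of_nat a \<in> semicircle (a, b) \<inter> semicircle (a, d)"
    using assms by (simp add: semicircle_iff)
  moreover have "crosses (a, b) (a, d) \<or> crosses (a, d) (a, b)"
    using assms by (auto simp: crosses_def)
  ultimately show ?thesis using semicircles_meet_once by blast
qed

datatype heading = Leftward | Rightward

fun target :: "arc \<Rightarrow> heading \<Rightarrow> nat" where
  "target (a, b) Leftward = a"
| "target (a, b) Rightward = b"

fun ahead :: "heading \<Rightarrow> complex \<Rightarrow> complex \<Rightarrow> bool" where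
  "ahead Leftward p q \<longleftrightarrow> Re q < Re p"
| "ahead Rightward p q \<longleftrightarrow> Re p < Re q"

definition meeting :: "letter list \<Rightarrow> arc \<Rightarrow> arc \<Rightarrow> complex \<Rightarrow> bool" where
  "meeting w e f z \<longleftrightarrow>
     f \<in> arcs w \<and> (crosses e f \<or> crosses f e) \<and> z \<in> semicircle e \<inter> semicircle f"

definition next_meeting ::
    "letter list \<Rightarrow> arc \<Rightarrow> heading \<Rightarrow> complex \<Rightarrow> arc \<Rightarrow> complex \<Rightarrow> bool" where
  "next_meeting w e h p f z \<longleftrightarrow> meeting w e f z \<and> ahead h p z \<and>
     (\<forall>f' z'. meeting w e f' z' \<and> ahead h p z' \<longrightarrow> \<not> ahead h z' z)"

text \<open>\<open>turn e f h\<close> is the arc and heading taken after reaching the meeting point of the crossing arcs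
  \<open>e\<close> and \<open>f\<close> along \<open>e\<close> with heading \<open>h\<close>. If \<open>crosses e f\<close>, then \<open>e = (a, b)\<close> and \<open>f = (c, d)\<close> with
  \<open>a \<le> c < b < d\<close>: coming from \<open>a\<close> one goes towards \<open>b\<close>, coming from \<open>b\<close> towards \<open>d\<close>. Otherwise
  \<open>e = (c, d)\<close> and \<open>f = (a, b)\<close>: coming from \<open>c\<close> one goes towards \<open>a\<close>, coming from \<open>d\<close> towards \<open>c\<close>.\<close>

definition turn :: "arc \<Rightarrow> arc \<Rightarrow> heading \<Rightarrow> arc \<times> heading" where
  "turn e f h =
     (if crosses e f
      then (case h of Rightward \<Rightarrow> (e, Rightward) | Leftward \<Rightarrow> (f, Rightward))
      else (case h of Rightward \<Rightarrow> (f, Leftward) | Leftward \<Rightarrow> (e, Leftward)))"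

text \<open>\<open>walk w e h p j\<close>: the walk leaving the point \<open>p\<close> along \<open>e\<close> with heading \<open>h\<close> ends at \<open>j\<close>. Only meeting
  points strictly ahead of \<open>p\<close> count. Hence, for the arcs \<open>(a, b)\<close> and \<open>(a, d)\<close> with \<open>b < d\<close>, a walk
  arriving at \<open>a\<close> from \<open>b\<close> goes on towards \<open>d\<close>, whereas one arriving from \<open>d\<close> keeps heading leftward,
  has no meeting point ahead, and stops at \<open>a\<close>.\<close>

inductive walk :: "letter list \<Rightarrow> arc \<Rightarrow> heading \<Rightarrow> complex \<Rightarrow> nat \<Rightarrow> bool" for w where
  stop: "\<not> (\<exists>f z. meeting w e f z \<and> ahead h p z) \<Longrightarrow> walk w e h p (target e h)"
| step: "next_meeting w e h p f z \<Longrightarrow> turn e f h = (e', h') \<Longrightarrow> walk w e' h' z j \<Longrightarrow> walk w e h p j"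

definition start :: "letter list \<Rightarrow> nat \<Rightarrow> arc \<Rightarrow> heading \<Rightarrow> bool" where
  "start w i e h \<longleftrightarrow> e \<in> arcs w \<and>
     (if letter_at w i = A
      then fst e = i \<and> (\<forall>f \<in> arcs w. fst f = i \<longrightarrow> snd e \<le> snd f) \<and> h = Rightward
      else snd e = i \<and> h = Leftward)"

definition trip_perm :: "letter list \<Rightarrow> nat \<Rightarrow> nat" where
  "trip_perm w i = (THE j. \<exists>e h. start w i e h \<and> walk w e h (of_nat i) j)"

end

theory Submission
  imports Defs
begin

text \<open>A partial promotion pushes the leading \<^const>\<open>A\<close> of a prefix to the right until it reaches the first letter
  \<open>x\<close> at which the number of \<open>x\<close>'s catches up with the number of \<^const>\<open>A\<close>'s; it replaces this letter, which travels to
  the end of the prefix. So evacuation emits letters one by one, from the right: in each step the first letter is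
  deleted, and the letter it runs into is emitted and replaced by \<^const>\<open>A\<close> (if there is none, \<^const>\<open>A\<close> is emitted).

  Let \<open>X\<close> and \<open>Y\<close> be the excess of \<^const>\<open>A\<close> over \<^const>\<open>B\<close> and over \<^const>\<open>C\<close> in a prefix. Each trip is simple. From an \<^const>\<open>A\<close>
  it runs straight to the nearer of its two partners. From a \<^const>\<open>B\<close> at \<open>i\<close> it alternates between the \<^const>\<open>B\<close>-arcs and
  the \<^const>\<open>C\<close>-arcs around \<open>i\<close>, moving outwards, until it fails to meet the next one. Whether it ends at a \<^const>\<open>C\<close> or at an
  \<^const>\<open>A\<close> can therefore be read off \<open>X\<close> and \<open>Y\<close> (\<open>emits\<close> below). This criterion makes sense for all
  prefixes of Kreweras words and is unchanged, at every surviving position, by a step of evacuation; at the first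
  position it predicts the emitted letter.\<close>

section \<open>Emission criterion on height paths\<close>

text \<open>Trips of different words are therefore never compared; only the criterion is. On heights
  a step of evacuation is mild: between the deleted letter and the hit both heights fall by one, and
  from the hit on only the height of the hit letter changes, rising by one. The criterion involves
  height differences only, so the difficulty lies in conditions that compare times on both sides of
  the hit. There it helps that the height of the hit letter vanishes at the hit and that both
  heights are positive before it. The index \<open>m\<close> of the criterion may change by one in
  such a step; the existential quantifier over \<open>m\<close> absorbs this.\<close>

definition height_path :: "(nat \<Rightarrow> int) \<Rightarrow> (nat \<Rightarrow> int) \<Rightarrow> nat \<Rightarrow> nat \<Rightarrow> bool" where
  "height_path H G lo N \<longleftrightarrow> H lo = 0 \<and> G lo = 0 \<and> (\<forall>t. lo \<le> t \<and> t \<le> N \<longrightarrow> 0 \<le> H t \<and> 0 \<le> G t) \<and>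
     (\<forall>t. lo \<le> t \<and> t < N \<longrightarrow>
        H (Suc t) = H t + 1 \<and> G (Suc t) = G t + 1 \<or>
        H (Suc t) = H t - 1 \<and> G (Suc t) = G t \<or>
        H (Suc t) = H t \<and> G (Suc t) = G t - 1)"

text \<open>\<open>emits H G lo N i\<close> describes, for the path starting at time \<open>lo\<close>, when the letter lowering \<open>H\<close> is the
  one produced by position \<open>i\<close>. In the arc picture for a position \<open>i\<close> lowering \<open>G\<close>: let \<open>e\<^sub>k\<close> and \<open>f\<^sub>k\<close> be the
  \<open>k\<close>-th \<open>G\<close>- and \<open>H\<close>-arcs around \<open>i\<close>, counted outwards, \<open>e\<^sub>0\<close> being the arc ending at \<open>i\<close>. Then \<open>rises\<close> says
  that \<open>f\<^sub>k\<^sub>+\<^sub>1\<close> opens to the right of \<open>e\<^sub>k\<close> (or at the same point) for all \<open>k < m\<close>, and \<open>drops\<close> that \<open>f\<^sub>m\<close> closes before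
  \<open>e\<^sub>m\<close> does. The least such \<open>m\<close> is the one at which the trip stops, but minimality need not be demanded.\<close>

definition drops :: "(nat \<Rightarrow> int) \<Rightarrow> (nat \<Rightarrow> int) \<Rightarrow> nat \<Rightarrow> nat \<Rightarrow> int \<Rightarrow> bool" where
  "drops H G N i m \<longleftrightarrow>
     (\<exists>q. i < q \<and> q \<le> N \<and> H q = H i - m \<and> (\<forall>t. i \<le> t \<and> t \<le> q \<longrightarrow> G i - m < G t))"

definition rises :: "(nat \<Rightarrow> int) \<Rightarrow> (nat \<Rightarrow> int) \<Rightarrow> nat \<Rightarrow> nat \<Rightarrow> int \<Rightarrow> bool" where
  "rises H G lo i m \<longleftrightarrow>
     (\<forall>t. lo \<le> t \<and> t < i \<longrightarrow> (\<exists>s. t \<le> s \<and> s < i \<and> min m (G (i - 1) - G t) \<le> H i - H s))"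

definition emits :: "(nat \<Rightarrow> int) \<Rightarrow> (nat \<Rightarrow> int) \<Rightarrow> nat \<Rightarrow> nat \<Rightarrow> nat \<Rightarrow> bool" where
  "emits H G lo N i \<longleftrightarrow>
     H i = H (i - 1) + 1 \<and> G i = G (i - 1) + 1 \<and> drops H G N i 1 \<or>
     G i = G (i - 1) - 1 \<and> (\<exists>m\<ge>1. drops H G N i m \<and> rises H G lo i m)"

lemma height_path_sym: "height_path H G lo N \<Longrightarrow> height_path G H lo N"
  unfolding height_path_def by blast

lemma height_path_nonneg:
  "height_path H G lo N \<Longrightarrow> lo \<le> t \<Longrightarrow> t \<le> N \<Longrightarrow> 0 \<le> H t"
  "height_path H G lo N \<Longrightarrow> lo \<le> t \<Longrightarrow> t \<le> N \<Longrightarrow> 0 \<le> G t"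
  unfolding height_path_def by blast+

lemma height_path_step:
  assumes "height_path H G lo N" "lo < i" "i \<le> N"
  obtains "H i = H (i - 1) + 1" "G i = G (i - 1) + 1"
    | "H i = H (i - 1) - 1" "G i = G (i - 1)"
    | "H i = H (i - 1)" "G i = G (i - 1) - 1"
proof -
  obtain j where "i = Suc j" using assms(2) by (cases i) auto
  then show thesis using assms that unfolding height_path_def
    by (metis Suc_le_lessD diff_Suc_1 less_Suc_eq_le)
qed

section \<open>First passage of a path at a level\<close>

lemma first_level:
  fixes H :: "nat \<Rightarrow> int"
  assumes "i \<le> q" and "\<And>t. i \<le> t \<Longrightarrow> t < q \<Longrightarrow> H t - 1 \<le> H (Suc t)"
    and "v < H i" "H q \<le> v"
  obtains r where "i < r" "r \<le> q" "H r = v" "\<And>t. i \<le> t \<Longrightarrow> t < r \<Longrightarrow> v < H t"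
proof -
  \<comment> \<open>A step lowers \<open>H\<close> by at most one, so the first time at or below
    \<open>v\<close> is a time exactly at \<open>v\<close>.\<close>
  define r where "r = (LEAST t. i \<le> t \<and> H t \<le> v)"
  have r: "i \<le> r" "H r \<le> v" and le: "r \<le> q"
    using LeastI[of "\<lambda>t. i \<le> t \<and> H t \<le> v" q] Least_le[of "\<lambda>t. i \<le> t \<and> H t \<le> v" q] assms
    by (auto simp: r_def)
  have lt: "v < H t" if "i \<le> t" "t < r" for t
    using not_less_Least[of t "\<lambda>t. i \<le> t \<and> H t \<le> v"] that by (fastforce simp: r_def)
  have "i < r" using r assms(3) by (cases "i = r") auto
  then obtain j where j: "r = Suc j" by (cases r) auto
  have "v < H j" using lt[of j] j \<open>i < r\<close> by simp
  then have "H r = v" using assms(2)[of j] j \<open>i < r\<close> le r by simp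
  then show thesis using that \<open>i < r\<close> le lt by blast
qed

lemma height_path_first_level:
  assumes "height_path H G lo N" "lo \<le> i" "i \<le> q" "q \<le> N" "v < H i" "H q \<le> v"
  obtains r where "i < r" "r \<le> q" "H r = v" "\<And>t. i \<le> t \<Longrightarrow> t < r \<Longrightarrow> v < H t"
proof (rule first_level[of i q H v])
  fix t assume "i \<le> t" "t < q"
  then have "lo < Suc t" "Suc t \<le> N" using assms by auto
  then show "H t - 1 \<le> H (Suc t)"
    using height_path_step[OF assms(1), of "Suc t"] by fastforce
qed (use assms that in auto)

lemma rises_mono:
  assumes "rises H G lo i m" "m' \<le> m"
  shows "rises H G lo i m'"
  unfolding rises_def
proof (intro allI impI)
  fix t assume "lo \<le> t \<and> t < i"
  then obtain s where "t \<le> s" "s < i" "min m (G (i - 1) - G t) \<le> H i - H s"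
    using assms(1) unfolding rises_def by blast
  then show "\<exists>s\<ge>t. s < i \<and> min m' (G (i - 1) - G t) \<le> H i - H s"
    using assms(2) by (intro exI[of _ s]) auto
qed

text \<open>Uniform shifts cancel in differences, so only the extra time \<open>t = lo\<close> of
  the longer path matters. Moving from \<open>lo + 1\<close> to \<open>lo\<close> raises the
  threshold by at most one, since \<open>G\<close> is one lower there, and the witness
  \<open>s = lo\<close> gains at least one, since \<open>H\<close> is 0 there and at least 1
  afterwards.\<close>

lemma rises_drop_first:
  assumes p: "height_path H G lo N" and pos: "\<And>t. lo < t \<Longrightarrow> t \<le> i \<Longrightarrow> 1 \<le> H t"
    and i: "lo + 1 < i" "i \<le> N"
    and G1: "G (lo + 1) = 1"
    and sh: "\<And>t. lo < t \<Longrightarrow> t \<le> i \<Longrightarrow> H' t = H t - 1 \<and> G' t = G t - 1"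
  shows "rises H' G' (lo + 1) i m \<longleftrightarrow> rises H G lo i m"
proof -
  have eq: "rises H' G' (lo + 1) i m \<longleftrightarrow> rises H G (lo + 1) i m"
    unfolding rises_def
  proof (intro iff_allI imp_cong refl ex_cong1 conj_cong)
    fix t s assume "lo + 1 \<le> t \<and> t < i" "t \<le> s" "s < i"
    then show "(min m (G' (i - 1) - G' t) \<le> H' i - H' s) = (min m (G (i - 1) - G t) \<le> H i - H s)"
      using sh[of t] sh[of s] sh[of i] sh[of "i - 1"] i by auto
  qed
  have "rises H G lo i m" if r: "rises H G (lo + 1) i m"
    unfolding rises_def
  proof (intro allI impI)
    fix t assume t: "lo \<le> t \<and> t < i"
    show "\<exists>s\<ge>t. s < i \<and> min m (G (i - 1) - G t) \<le> H i - H s"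
    proof (cases "t = lo")
      case False then show ?thesis using r t unfolding rises_def by auto
    next
      case True
      obtain s where s: "lo + 1 \<le> s" "s < i" "min m (G (i - 1) - G (lo + 1)) \<le> H i - H s"
        using r i unfolding rises_def by blast
      have "1 \<le> H s" using pos[of s] s by simp
      moreover have "H lo = 0" "G lo = 0" using p by (auto simp: height_path_def)
      ultimately show ?thesis using s G1 True i by (intro exI[of _ lo]) auto
    qed
  qed
  moreover have "rises H G (lo + 1) i m" if "rises H G lo i m"
    using that unfolding rises_def by auto
  ultimately show ?thesis using eq by blast
qed

lemma drops_shift:
  assumes "\<And>t. i \<le> t \<Longrightarrow> t \<le> N \<Longrightarrow> H' t = H t + h \<and> G' t = G t + g" "i \<le> N"
  shows "drops H' G' N i m \<longleftrightarrow> drops H G N i m"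
  unfolding drops_def
proof (intro ex_cong1 conj_cong refl iff_allI imp_cong)
  fix q assume "i < q" "q \<le> N"
  then show "(H' q = H' i - m) = (H q = H i - m)" using assms(1)[of q] assms(1)[of i] assms(2) by auto
next
  fix q t assume "i < q" "q \<le> N" "i \<le> t \<and> t \<le> q"
  then show "(G' i - m < G' t) = (G i - m < G t)"
    using assms(1)[of t] assms(1)[of i] assms(2) by auto
qed

text \<open>Here the leading \<open>A\<close> passes every letter and is itself emitted: both
  heights are one lower throughout, and only differences enter.\<close>

lemma emits_no_hit:
  assumes p: "height_path H G lo N" and pos: "\<And>t. lo < t \<Longrightarrow> t \<le> N \<Longrightarrow> 1 \<le> H t \<and> 1 \<le> G t"
    and sh: "\<And>t. lo < t \<Longrightarrow> t \<le> N \<Longrightarrow> H' t = H t - 1 \<and> G' t = G t - 1"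
    and i: "lo + 1 < i" "i \<le> N"
  shows "emits H' G' (lo + 1) N i \<longleftrightarrow> emits H G lo N i"
proof -
  have G1: "G (lo + 1) = 1"
    using height_path_step[OF p, of "lo + 1"] pos[of "lo + 1"] p i
    by (auto simp: height_path_def)
  have d: "drops H' G' N i m \<longleftrightarrow> drops H G N i m" for m
    using drops_shift[of i N H' H "-1" G' G "-1"] sh i by simp
  have r: "rises H' G' (lo + 1) i m \<longleftrightarrow> rises H G lo i m" for m
    using rises_drop_first[OF p _ i G1] pos sh i by simp
  have "H' i = H i - 1" "G' i = G i - 1" "H' (i - 1) = H (i - 1) - 1" "G' (i - 1) = G (i - 1) - 1"
    using sh[of i] sh[of "i - 1"] i by auto
  then show ?thesis unfolding emits_def d r by auto
qed

section \<open>Invariance under a promotion step that hits a letter\<close>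

text \<open>One promotion step in terms of heights: the first letter is deleted and the letter at \<open>h\<close>, where \<open>R\<close>
  returns to \<open>0\<close> for the first time, becomes \<^const>\<open>A\<close>. Times are not shifted, so the new path starts at \<open>lo + 1\<close>.\<close>

locale promotion_hit =
  fixes R S R' S' :: "nat \<Rightarrow> int" and lo N h :: nat
  assumes path: "height_path R S lo N"
    and h: "lo < h" "h \<le> N"
    and pos: "\<And>t. lo < t \<Longrightarrow> t < h \<Longrightarrow> 1 \<le> R t \<and> 1 \<le> S t"
    and Rh: "R h = 0" and Sh: "1 \<le> S h"
    and before: "\<And>t. lo < t \<Longrightarrow> t < h \<Longrightarrow> R' t = R t - 1 \<and> S' t = S t - 1"
    and after: "\<And>t. h \<le> t \<Longrightarrow> t \<le> N \<Longrightarrow> R' t = R t + 1 \<and> S' t = S t"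
begin

lemma nonneg: "lo \<le> t \<Longrightarrow> t \<le> N \<Longrightarrow> 0 \<le> R t" "lo \<le> t \<Longrightarrow> t \<le> N \<Longrightarrow> 0 \<le> S t"
  using height_path_nonneg[OF path] by auto

lemma first_heights: "lo + 1 < h" "R (lo + 1) = 1" "S (lo + 1) = 1"
proof -
  have z: "R lo = 0" "S lo = 0" using path by (auto simp: height_path_def)
  show eq: "R (lo + 1) = 1" "S (lo + 1) = 1"
    by (rule height_path_step[OF path, of "lo + 1"]; use nonneg[of "lo + 1"] z h in simp)+
  show "lo + 1 < h" using h eq Rh by (cases "h = lo + 1") auto
qed

lemma hit_step: "R (h - 1) = 1" "S (h - 1) = S h"
proof -
  have "1 \<le> R (h - 1)" using pos[of "h - 1"] first_heights by auto
  then show "R (h - 1) = 1" "S (h - 1) = S h"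
    using height_path_step[OF path h] Rh by force+
qed

lemma after_R_pos: "lo < t \<Longrightarrow> t \<le> N \<Longrightarrow> 0 \<le> R' t"
  using before[of t] after[of t] pos[of t] nonneg[of t] by (cases "t < h") auto

text \<open>Since \<open>R\<close> vanishes at \<open>h\<close>, for \<open>m\<close> at most
  \<open>R (i - 1)\<close> the condition of \<open>rises\<close> at time \<open>h\<close> already
  demands the full gain \<open>m\<close>, and its witness serves all earlier times. Larger
  \<open>m\<close> can be lowered to that bound.\<close>

lemma emits_after_hit_S:
  assumes i: "h < i" "i \<le> N"
  shows "emits S' R' (lo + 1) N i \<longleftrightarrow> emits S R lo N i"
proof -
  have d: "drops S' R' N i m \<longleftrightarrow> drops S R N i m" for m
    using drops_shift[of i N S' S 0 R' R 1] after i by simp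
  have e: "S' i = S i" "R' i = R i + 1" "S' (i - 1) = S (i - 1)" "R' (i - 1) = R (i - 1) + 1"
    using after[of i] after[of "i - 1"] i by auto
  have r: "rises S' R' (lo + 1) i m \<longleftrightarrow> rises S R lo i m" if m: "m \<le> R (i - 1)" for m
  proof
    assume L: "rises S' R' (lo + 1) i m"
    obtain s0 where s0: "h \<le> s0" "s0 < i" "m \<le> S i - S s0"
    proof -
      obtain s where "h \<le> s" "s < i" "min m (R' (i - 1) - R' h) \<le> S' i - S' s"
        using L first_heights i unfolding rises_def by (meson Suc_eq_plus1 le_less less_le_trans)
      then show thesis using that[of s] after[of s] after[of h] e m Rh i by auto
    qed
    show "rises S R lo i m" unfolding rises_def
    proof (intro allI impI)
      fix t assume t: "lo \<le> t \<and> t < i"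
      show "\<exists>s\<ge>t. s < i \<and> min m (R (i - 1) - R t) \<le> S i - S s"
      proof (cases "t < h")
        case True then show ?thesis using s0 by (intro exI[of _ s0]) auto
      next
        case False
        then obtain s where "t \<le> s" "s < i" "min m (R' (i - 1) - R' t) \<le> S' i - S' s"
          using L t h unfolding rises_def
          by (metis Suc_eq_plus1 Suc_leI less_le_trans not_less)
        then show ?thesis using after[of s] after[of t] e False i t by (intro exI[of _ s]) auto
      qed
    qed
  next
    assume L: "rises S R lo i m"
    obtain s0 where s0: "h \<le> s0" "s0 < i" "m \<le> S i - S s0"
    proof -
      obtain s where "h \<le> s" "s < i" "min m (R (i - 1) - R h) \<le> S i - S s"
        using L h i unfolding rises_def by (meson less_imp_le)
      then show thesis using that[of s] m Rh by auto
    qed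
    show "rises S' R' (lo + 1) i m" unfolding rises_def
    proof (intro allI impI)
      fix t assume t: "lo + 1 \<le> t \<and> t < i"
      show "\<exists>s\<ge>t. s < i \<and> min m (R' (i - 1) - R' t) \<le> S' i - S' s"
      proof (cases "t < h")
        case True then show ?thesis using s0 after[of s0] e i by (intro exI[of _ s0]) auto
      next
        case False
        have "lo \<le> t" "t < i" using t by auto
        then obtain s where "t \<le> s" "s < i" "min m (R (i - 1) - R t) \<le> S i - S s"
          using L unfolding rises_def by blast
        then show ?thesis using after[of s] after[of t] e False i t by (intro exI[of _ s]) auto
      qed
    qed
  qed
  \<comment> \<open>With \<open>m0 = R (i - 1)\<close> the bound \<open>R i - m0\<close> is -1, so
    the condition on \<open>R\<close> in \<open>drops\<close> holds automatically and
    \<open>S\<close> only has to reach the earlier level.\<close>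
  have small: "\<exists>m. 1 \<le> m \<and> m \<le> R (i - 1) \<and> drops S R N i m \<and> rises f g k i m"
    if Rd: "R i = R (i - 1) - 1" and m: "1 \<le> m" "drops S R N i m" "rises f g k i m" for m f g k
  proof (cases "m \<le> R (i - 1)")
    case True then show ?thesis using m by blast
  next
    case False
    define m0 where "m0 = R (i - 1)"
    have m0: "1 \<le> m0" "m0 \<le> m" using nonneg[of i] Rd i h False by (auto simp: m0_def)
    obtain q where q: "i < q" "q \<le> N" "S q = S i - m" using m(2) unfolding drops_def by blast
    obtain q0 where q0: "i < q0" "q0 \<le> q" "S q0 = S i - m0"
      using height_path_first_level[OF height_path_sym[OF path], of i q "S i - m0"] i h q m0 by auto
    have "R i - m0 < R t" if "i \<le> t" "t \<le> q0" for t
      using nonneg[of t] that q0 q h i Rd by (auto simp: m0_def)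
    then have "drops S R N i m0" unfolding drops_def using q0 q by (intro exI[of _ q0]) auto
    then show ?thesis using rises_mono[OF m(3) m0(2)] m0 by (auto simp: m0_def)
  qed
  have "(\<exists>m\<ge>1. drops S R N i m \<and> rises S' R' (lo + 1) i m) \<longleftrightarrow>
        (\<exists>m\<ge>1. drops S R N i m \<and> rises S R lo i m)" if "R i = R (i - 1) - 1"
    using small[OF that] r by meson
  then show ?thesis unfolding emits_def d using e by auto
qed

text \<open>As \<open>R\<close> stays nonnegative, a drop by \<open>m\<close> forces
  \<open>m\<close> to be at most \<open>R i\<close>; because \<open>R h = 0\<close>, the witness
  \<open>s = h\<close> then satisfies \<open>rises\<close> at every time before \<open>h\<close>,
  for the old path and for the new one.\<close>

lemma emits_after_hit_R:
  assumes i: "h < i" "i \<le> N"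
  shows "emits R' S' (lo + 1) N i \<longleftrightarrow> emits R S lo N i"
proof -
  have d: "drops R' S' N i m \<longleftrightarrow> drops R S N i m" for m
    using drops_shift[of i N R' R 1 S' S 0] after i by simp
  have e: "S' i = S i" "R' i = R i + 1" "S' (i - 1) = S (i - 1)" "R' (i - 1) = R (i - 1) + 1"
    using after[of i] after[of "i - 1"] i by auto
  have r: "rises R' S' (lo + 1) i m \<longleftrightarrow> rises R S lo i m" if m: "drops R S N i m" for m
  proof -
    obtain q where "i < q" "q \<le> N" "R q = R i - m" using m unfolding drops_def by blast
    then have mi: "m \<le> R i" using nonneg(1)[of q] i h by auto
    have same: "(\<exists>s\<ge>t. s < i \<and> min m (S' (i - 1) - S' t) \<le> R' i - R' s) \<longleftrightarrow>
          (\<exists>s\<ge>t. s < i \<and> min m (S (i - 1) - S t) \<le> R i - R s)" if "h \<le> t" "t < i" for t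
    proof (intro ex_cong1 conj_cong refl)
      fix s assume "t \<le> s" "s < i"
      then show "(min m (S' (i - 1) - S' t) \<le> R' i - R' s) = (min m (S (i - 1) - S t) \<le> R i - R s)"
        using after[of s] after[of t] e that i by auto
    qed
    have 1: "\<exists>s\<ge>t. s < i \<and> min m (S (i - 1) - S t) \<le> R i - R s" if "t < h" for t
      using that i mi Rh by (intro exI[of _ h]) auto
    have 2: "\<exists>s\<ge>t. s < i \<and> min m (S' (i - 1) - S' t) \<le> R' i - R' s" if "t < h" for t
      using that i mi Rh e after[of h] h by (intro exI[of _ h]) auto
    show ?thesis
    proof
      assume L: "rises R' S' (lo + 1) i m"
      show "rises R S lo i m" unfolding rises_def
      proof (intro allI impI)
        fix t assume t: "lo \<le> t \<and> t < i"
        show "\<exists>s\<ge>t. s < i \<and> min m (S (i - 1) - S t) \<le> R i - R s"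
        proof (cases "t < h")
          case False
          then have "lo + 1 \<le> t \<and> t < i" using t h by simp
          then show ?thesis using L same[of t] False unfolding rises_def by auto
        qed (rule 1)
      qed
    next
      assume L: "rises R S lo i m"
      show "rises R' S' (lo + 1) i m" unfolding rises_def
      proof (intro allI impI)
        fix t assume t: "lo + 1 \<le> t \<and> t < i"
        show "\<exists>s\<ge>t. s < i \<and> min m (S' (i - 1) - S' t) \<le> R' i - R' s"
        proof (cases "t < h")
          case False
          then show ?thesis using L same[of t] t unfolding rises_def by auto
        qed (rule 2)
      qed
    qed
  qed
  then show ?thesis unfolding emits_def d using e by auto
qed

text \<open>The old letter at \<open>h\<close> lowers \<open>R\<close> and the new one is
  \<open>A\<close>, so different clauses of \<open>emits\<close> are compared. For the old letter
  \<open>rises\<close> holds for every \<open>m\<close>, because \<open>R (h - 1) = 1\<close> and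
  \<open>R\<close> is positive between \<open>lo\<close> and \<open>h\<close>, while
  \<open>lo\<close> is its own witness; and \<open>drops\<close> for some \<open>m\<close> amounts
  to \<open>drops\<close> for 1, the condition for \<open>A\<close>.\<close>

lemma emits_at_hit_S: "emits S' R' (lo + 1) N h \<longleftrightarrow> emits S R lo N h"
proof -
  have h1: "R' (h - 1) = 0" "S' (h - 1) = S h - 1" "R' h = 1" "S' h = S h"
    using before[of "h - 1"] after[of h] hit_step first_heights Rh h by auto
  have "rises S R lo h m" for m
    unfolding rises_def
  proof (intro allI impI)
    fix t assume t: "lo \<le> t \<and> t < h"
    show "\<exists>s\<ge>t. s < h \<and> min m (R (h - 1) - R t) \<le> S h - S s"
    proof (cases "t = lo")
      case True then show ?thesis
        using Sh h hit_step path by (intro exI[of _ lo]) (auto simp: height_path_def)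
    next
      case False then show ?thesis
        using pos[of t] t hit_step by (intro exI[of _ "h - 1"]) auto
    qed
  qed
  then have L: "emits S R lo N h \<longleftrightarrow> (\<exists>m\<ge>1. drops S R N h m)"
    unfolding emits_def using hit_step Rh by auto
  have M: "(\<exists>m\<ge>1. drops S R N h m) \<longleftrightarrow> drops S R N h 1"
  proof
    assume "\<exists>m\<ge>1. drops S R N h m"
    then obtain m q where m: "1 \<le> m" "h < q" "q \<le> N" "S q = S h - m" unfolding drops_def by blast
    obtain q0 where q0: "h < q0" "q0 \<le> q" "S q0 = S h - 1"
      using height_path_first_level[OF height_path_sym[OF path], of h q "S h - 1"] h m by auto
    have "R h - 1 < R t" if "h \<le> t" "t \<le> q0" for t
      using nonneg[of t] that q0 m h Rh by auto
    then show "drops S R N h 1" unfolding drops_def using q0 m by (intro exI[of _ q0]) auto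
  qed auto
  have "drops S' R' N h 1 \<longleftrightarrow> drops S R N h 1"
    using drops_shift[of h N S' S 0 R' R 1] after h by simp
  moreover have "emits S' R' (lo + 1) N h \<longleftrightarrow> drops S' R' N h 1" unfolding emits_def using h1 by auto
  ultimately show ?thesis using L M by simp
qed

text \<open>Both sides are false: the old letter lowers \<open>R\<close> itself, and for the new
  \<open>A\<close> the height \<open>R\<close> would have to fall to -1.\<close>

lemma emits_at_hit_R: "emits R' S' (lo + 1) N h \<longleftrightarrow> emits R S lo N h"
proof -
  have h1: "R' (h - 1) = 0" "S' (h - 1) = S h - 1" "R' h = 1" "S' h = S h"
    using before[of "h - 1"] after[of h] hit_step first_heights Rh h by auto
  have "\<not> drops R' S' N h 1"
  proof
    assume "drops R' S' N h 1"
    then obtain q where "h < q" "q \<le> N" "R' q = R' h - 1" unfolding drops_def by blast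
    then show False using after[of q] nonneg[of q] h h1 by auto
  qed
  then show ?thesis unfolding emits_def using h1 hit_step Rh by auto
qed

lemma rises_before_hit:
  assumes "lo + 1 < i" "i < h"
  shows "rises S' R' (lo + 1) i m \<longleftrightarrow> rises S R lo i m"
    and "rises R' S' (lo + 1) i m \<longleftrightarrow> rises R S lo i m"
proof -
  have "i \<le> N" using assms h by simp
  then show "rises S' R' (lo + 1) i m \<longleftrightarrow> rises S R lo i m"
    using rises_drop_first[OF height_path_sym[OF path] _ assms(1) _ first_heights(2), of S' R'] pos before assms by auto
  show "rises R' S' (lo + 1) i m \<longleftrightarrow> rises R S lo i m"
    using \<open>i \<le> N\<close> rises_drop_first[OF path _ assms(1) _ first_heights(3), of R' S'] pos before assms by auto
qed

text \<open>An \<open>A\<close> before the hit starts from a value of \<open>R\<close> that is at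
  least 1, and \<open>R\<close> has to pass this value again on its way to 0 at
  \<open>h\<close>.\<close>

lemma first_return_before_hit:
  assumes i: "lo + 1 < i" "i < h" and up: "R i = R (i - 1) + 1"
  obtains q where "i < q" "q < h" "R q = R i - 1" "\<And>t. i \<le> t \<Longrightarrow> t < q \<Longrightarrow> R i - 1 < R t"
proof -
  have R1: "1 \<le> R i - 1" using pos[of "i - 1"] i up by auto
  obtain q where q: "i < q" "q \<le> h" "R q = R i - 1" "\<And>t. i \<le> t \<Longrightarrow> t < q \<Longrightarrow> R i - 1 < R t"
    using height_path_first_level[OF path, of i h "R i - 1"] i h Rh R1 by auto
  then have "q \<noteq> h" using Rh R1 by auto
  then show thesis using that q by auto
qed

text \<open>Both conditions ask which of \<open>R\<close> and \<open>S\<close> first loses the unit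
  gained at \<open>i\<close>. The return of \<open>R\<close> at \<open>q1 < h\<close> decides this,
  so only times before the hit are consulted, where both heights are uniformly one lower.\<close>

lemma drops_before_hit_up:
  assumes i: "lo + 1 < i" "i < h" and up: "R i = R (i - 1) + 1"
  shows "drops R' S' N i 1 \<longleftrightarrow> drops R S N i 1" "drops S' R' N i 1 \<longleftrightarrow> drops S R N i 1"
proof -
  obtain q1 where q1: "i < q1" "q1 < h" "R q1 = R i - 1" "\<And>t. i \<le> t \<Longrightarrow> t < q1 \<Longrightarrow> R i - 1 < R t"
    using first_return_before_hit[OF assms] by blast
  have b: "R' t = R t - 1" "S' t = S t - 1" if "i \<le> t" "t < h" for t
    using before[of t] that i by auto
  have lt: "R' i - 1 < R' t" if "i \<le> t" "t < q1" for t
    using q1(4)[OF that] b[of i] b[of t] that q1(1,2) by auto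
  have "drops R S N i 1 \<longleftrightarrow> (\<forall>t. i \<le> t \<and> t \<le> q1 \<longrightarrow> S i - 1 < S t)"
    unfolding drops_def
  proof
    assume "\<exists>q>i. q \<le> N \<and> R q = R i - 1 \<and> (\<forall>t. i \<le> t \<and> t \<le> q \<longrightarrow> S i - 1 < S t)"
    then obtain q where q: "i < q" "R q = R i - 1" "\<forall>t. i \<le> t \<and> t \<le> q \<longrightarrow> S i - 1 < S t" by blast
    have "q1 \<le> q" using q1(4)[of q] q by (cases "q < q1") auto
    then show "\<forall>t. i \<le> t \<and> t \<le> q1 \<longrightarrow> S i - 1 < S t" using q by auto
  qed (use q1 h in \<open>auto intro!: exI[of _ q1]\<close>)
  moreover have "drops R' S' N i 1 \<longleftrightarrow> (\<forall>t. i \<le> t \<and> t \<le> q1 \<longrightarrow> S' i - 1 < S' t)"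
    unfolding drops_def
  proof
    assume "\<exists>q>i. q \<le> N \<and> R' q = R' i - 1 \<and> (\<forall>t. i \<le> t \<and> t \<le> q \<longrightarrow> S' i - 1 < S' t)"
    then obtain q where q: "i < q" "R' q = R' i - 1" "\<forall>t. i \<le> t \<and> t \<le> q \<longrightarrow> S' i - 1 < S' t" by blast
    have "q1 \<le> q" using lt[of q] q by (cases "q < q1") auto
    then show "\<forall>t. i \<le> t \<and> t \<le> q1 \<longrightarrow> S' i - 1 < S' t" using q by auto
  qed (use q1 h b[of i] b[of q1] in \<open>auto intro!: exI[of _ q1]\<close>)
  moreover have "(\<forall>t. i \<le> t \<and> t \<le> q1 \<longrightarrow> S' i - 1 < S' t) \<longleftrightarrow> (\<forall>t. i \<le> t \<and> t \<le> q1 \<longrightarrow> S i - 1 < S t)"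
    using b q1 i by auto
  ultimately show "drops R' S' N i 1 \<longleftrightarrow> drops R S N i 1" by simp
  have "drops S R N i 1 \<longleftrightarrow> (\<exists>q. i < q \<and> q < q1 \<and> S q = S i - 1)"
    unfolding drops_def
  proof
    assume "\<exists>q>i. q \<le> N \<and> S q = S i - 1 \<and> (\<forall>t. i \<le> t \<and> t \<le> q \<longrightarrow> R i - 1 < R t)"
    then obtain q where q: "i < q" "S q = S i - 1" "\<forall>t. i \<le> t \<and> t \<le> q \<longrightarrow> R i - 1 < R t" by blast
    then have "q < q1" using q1 by (metis less_imp_le linorder_not_less less_irrefl)
    then show "\<exists>q. i < q \<and> q < q1 \<and> S q = S i - 1" using q by blast
  next
    assume "\<exists>q. i < q \<and> q < q1 \<and> S q = S i - 1"
    then obtain q where "i < q" "q < q1" "S q = S i - 1" by blast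
    then show "\<exists>q>i. q \<le> N \<and> S q = S i - 1 \<and> (\<forall>t. i \<le> t \<and> t \<le> q \<longrightarrow> R i - 1 < R t)"
      using q1 h by (intro exI[of _ q]) auto
  qed
  moreover have "drops S' R' N i 1 \<longleftrightarrow> (\<exists>q. i < q \<and> q < q1 \<and> S' q = S' i - 1)"
    unfolding drops_def
  proof
    assume "\<exists>q>i. q \<le> N \<and> S' q = S' i - 1 \<and> (\<forall>t. i \<le> t \<and> t \<le> q \<longrightarrow> R' i - 1 < R' t)"
    then obtain q where q: "i < q" "S' q = S' i - 1" "\<forall>t. i \<le> t \<and> t \<le> q \<longrightarrow> R' i - 1 < R' t" by blast
    have "R' q1 = R' i - 1" using b[of q1] b[of i] q1 i by auto
    then have "q < q1" using q q1(1) by (metis less_imp_le linorder_not_less less_irrefl)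
    then show "\<exists>q. i < q \<and> q < q1 \<and> S' q = S' i - 1" using q by blast
  next
    assume "\<exists>q. i < q \<and> q < q1 \<and> S' q = S' i - 1"
    then obtain q where "i < q" "q < q1" "S' q = S' i - 1" by blast
    then show "\<exists>q>i. q \<le> N \<and> S' q = S' i - 1 \<and> (\<forall>t. i \<le> t \<and> t \<le> q \<longrightarrow> R' i - 1 < R' t)"
      using q1 h lt by (intro exI[of _ q]) auto
  qed
  moreover have "(\<exists>q. i < q \<and> q < q1 \<and> S' q = S' i - 1) \<longleftrightarrow> (\<exists>q. i < q \<and> q < q1 \<and> S q = S i - 1)"
    using b q1 i by auto
  ultimately show "drops S' R' N i 1 \<longleftrightarrow> drops S R N i 1" by simp
qed

text \<open>If \<open>S\<close> drops before the hit, \<open>m\<close> stays. Otherwise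
  \<open>S\<close> is compared across the hit, where its shift jumps from -1 to 0: then
  \<open>m\<close> for the new path corresponds to \<open>m + 1\<close> for the old one.\<close>

lemma emits_before_hit_S:
  assumes i: "lo + 1 < i" "i < h"
  shows "emits S' R' (lo + 1) N i \<longleftrightarrow> emits S R lo N i"
proof -
  have b: "R' t = R t - 1" "S' t = S t - 1" if "lo < t" "t < h" for t
    using before[of t] that by auto
  have e: "S' i = S i - 1" "R' i = R i - 1" "S' (i - 1) = S (i - 1) - 1" "R' (i - 1) = R (i - 1) - 1"
    using b[of i] b[of "i - 1"] i by auto
  have R1: "1 \<le> R i" using pos[of i] i by auto
  have "(\<exists>m\<ge>1. drops S' R' N i m \<and> rises S R lo i m) \<longleftrightarrow>
        (\<exists>m\<ge>1. drops S R N i m \<and> rises S R lo i m)" if Rd: "R i = R (i - 1) - 1"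
  proof
    assume "\<exists>m\<ge>1. drops S' R' N i m \<and> rises S R lo i m"
    then obtain m q where m: "1 \<le> m" "rises S R lo i m" and
      q: "i < q" "q \<le> N" "S' q = S' i - m" "\<forall>t. i \<le> t \<and> t \<le> q \<longrightarrow> R' i - m < R' t"
      unfolding drops_def by blast
    show "\<exists>m\<ge>1. drops S R N i m \<and> rises S R lo i m"
    proof (cases "q < h")
      case True
      have "drops S R N i m" unfolding drops_def
        using q b[of q] e True i by (intro exI[of _ q]) (auto simp: b)
      then show ?thesis using m by blast
    next
      case False
      \<comment> \<open>\<open>R'\<close> touches 0 right before the hit, which forces
        \<open>R i \<le> m\<close>; so the bound on \<open>R\<close> for \<open>m + 1\<close> is
        negative.\<close>
      have "R' (h - 1) = 0" using hit_step b[of "h - 1"] first_heights by auto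
      moreover have "i \<le> h - 1 \<and> h - 1 \<le> q" using False i by auto
      ultimately have mR: "R i \<le> m" using q(4)[rule_format, of "h - 1"] e by auto
      have "S q = S i - (m + 1)" using q(3) after[of q] False q e by auto
      moreover have "R i - (m + 1) < R t" if "i \<le> t" "t \<le> q" for t
        using nonneg[of t] that q i mR by auto
      ultimately have "drops S R N i (m + 1)" unfolding drops_def using q by blast
      moreover have "rises S R lo i (m + 1)" unfolding rises_def
      proof (intro allI impI)
        fix t assume t: "lo \<le> t \<and> t < i"
        show "\<exists>s\<ge>t. s < i \<and> min (m + 1) (R (i - 1) - R t) \<le> S i - S s"
        \<comment> \<open>After \<open>lo\<close> the larger cap \<open>m + 1\<close> changes
          nothing, as \<open>R (i - 1) - R t\<close> is at most \<open>R i \<le> m\<close>; at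
          \<open>lo\<close> the value \<open>S lo = 0\<close> provides the extra unit.\<close>
        proof (cases "t = lo")
          case False
          obtain s where s: "t \<le> s" "s < i" "min m (R (i - 1) - R t) \<le> S i - S s"
            using m(2) t unfolding rises_def by blast
          have "1 \<le> R t" using pos[of t] t False i by auto
          then show ?thesis using s mR Rd by (intro exI[of _ s]) auto
        next
          case True
          obtain s where s: "lo + 1 \<le> s" "s < i" "min m (R (i - 1) - R (lo + 1)) \<le> S i - S s"
            using m(2) i unfolding rises_def by (metis le_add1)
          have "1 \<le> S s" using pos[of s] s i by auto
          moreover have "S lo = 0" "R lo = 0" using path by (auto simp: height_path_def)
          ultimately show ?thesis using s mR Rd True i first_heights by (intro exI[of _ lo]) auto
        qed
      qed
      ultimately show ?thesis using m by (intro exI[of _ "m + 1"]) auto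
    qed
  next
    assume "\<exists>m\<ge>1. drops S R N i m \<and> rises S R lo i m"
    then obtain m q where m: "1 \<le> m" "rises S R lo i m" and
      q: "i < q" "q \<le> N" "S q = S i - m" "\<forall>t. i \<le> t \<and> t \<le> q \<longrightarrow> R i - m < R t"
      unfolding drops_def by blast
    show "\<exists>m\<ge>1. drops S' R' N i m \<and> rises S R lo i m"
    proof (cases "q < h")
      case True
      have "drops S' R' N i m" unfolding drops_def
        using q b[of q] e True i by (intro exI[of _ q]) (auto simp: b)
      then show ?thesis using m by blast
    next
      case False
      then have mR: "R i < m" using q(4)[rule_format, of h] i Rh by auto
      have "S' q = S' i - (m - 1)" using q(3) after[of q] False q e by auto
      moreover have "R' i - (m - 1) < R' t" if "i \<le> t" "t \<le> q" for t
        using after_R_pos[of t] that q i mR e by auto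
      ultimately have "drops S' R' N i (m - 1)" unfolding drops_def using q by blast
      moreover have "rises S R lo i (m - 1)" using rises_mono m by auto
      ultimately show ?thesis using R1 mR by (intro exI[of _ "m - 1"]) auto
    qed
  qed
  then show ?thesis unfolding emits_def rises_before_hit[OF i]
    using e drops_before_hit_up[OF i] by auto
qed

text \<open>The drop of \<open>R\<close> can be moved before the hit, where old and new heights
  differ by a constant. For the new path this holds since \<open>R'\<close> is at least 1 from
  \<open>h\<close> on; for the old path the only obstruction is a drop to level 0, which is first
  reached at \<open>h\<close>.\<close>

lemma emits_before_hit_R:
  assumes i: "lo + 1 < i" "i < h"
  shows "emits R' S' (lo + 1) N i \<longleftrightarrow> emits R S lo N i"
proof -
  have b: "R' t = R t - 1" "S' t = S t - 1" if "lo < t" "t < h" for t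
    using before[of t] that by auto
  have e: "S' i = S i - 1" "R' i = R i - 1" "S' (i - 1) = S (i - 1) - 1" "R' (i - 1) = R (i - 1) - 1"
    using b[of i] b[of "i - 1"] i by auto
  have S1: "1 \<le> S i" using pos[of i] i by auto
  have "(\<exists>m\<ge>1. drops R' S' N i m \<and> rises R S lo i m) \<longleftrightarrow>
        (\<exists>m\<ge>1. drops R S N i m \<and> rises R S lo i m)" if Sd: "S i = S (i - 1) - 1"
  proof
    assume "\<exists>m\<ge>1. drops R' S' N i m \<and> rises R S lo i m"
    then obtain m q where m: "1 \<le> m" "rises R S lo i m" and
      q: "i < q" "q \<le> N" "R' q = R' i - m" "\<forall>t. i \<le> t \<and> t \<le> q \<longrightarrow> S' i - m < S' t"
      unfolding drops_def by blast
    have "\<exists>q0. i < q0 \<and> q0 \<le> q \<and> q0 < h \<and> R q0 = R i - m"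
    proof (cases "q < h")
      case True then show ?thesis using q b[of q] e i by auto
    next
      case False
      then have "1 \<le> R i - 1 - m" using q(3) after[of q] nonneg[of q] q i h e by auto
      then obtain q0 where "i < q0" "q0 \<le> h" "R q0 = R i - m"
        using height_path_first_level[OF path, of i h "R i - m"] i h Rh m by auto
      moreover have "q0 \<noteq> h" using calculation \<open>1 \<le> R i - 1 - m\<close> Rh by auto
      ultimately show ?thesis using False by (intro exI[of _ q0]) auto
    qed
    then obtain q0 where q0: "i < q0" "q0 \<le> q" "q0 < h" "R q0 = R i - m" by blast
    have "S i - m < S t" if "i \<le> t" "t \<le> q0" for t
      using q(4)[rule_format, of t] that q0 b[of t] e i by auto
    then have "drops R S N i m" unfolding drops_def using q0 h by (intro exI[of _ q0]) auto
    then show "\<exists>m\<ge>1. drops R S N i m \<and> rises R S lo i m" using m by blast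
  next
    assume ex: "\<exists>m\<ge>1. drops R S N i m \<and> rises R S lo i m"
    \<comment> \<open>Minimality excludes a drop to level 0 at \<open>h\<close>: in that case
      \<open>k - 1\<close> would satisfy both conditions as well.\<close>
    define k where "k = (LEAST k. 1 \<le> k \<and> drops R S N i (int k) \<and> rises R S lo i (int k))"
    obtain m0 where "1 \<le> m0" "drops R S N i m0" "rises R S lo i m0" using ex by blast
    then have "1 \<le> nat m0 \<and> drops R S N i (int (nat m0)) \<and> rises R S lo i (int (nat m0))" by simp
    then have k: "1 \<le> k" "drops R S N i (int k)" "rises R S lo i (int k)"
      unfolding k_def by (metis (mono_tags, lifting) LeastI)+
    have kmin: "\<not> (1 \<le> k' \<and> drops R S N i (int k') \<and> rises R S lo i (int k'))" if "k' < k" for k'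
      using not_less_Least[of k'] that unfolding k_def by blast
    obtain q where q: "i < q" "q \<le> N" "R q = R i - int k" "\<forall>t. i \<le> t \<and> t \<le> q \<longrightarrow> S i - int k < S t"
      using k(2) unfolding drops_def by blast
    have "\<exists>q0. i < q0 \<and> q0 \<le> q \<and> q0 < h \<and> R q0 = R i - int k"
    proof (rule ccontr)
      assume no: "\<not> ?thesis"
      then have qh: "h \<le> q" using q(1,3) by (metis leI order_refl)
      have kR: "int k \<le> R i" using q(3) nonneg[of q] q i by auto
      obtain q0 where q0: "i < q0" "q0 \<le> h" "R q0 = R i - int k"
        using height_path_first_level[OF path, of i h "R i - int k"] i h Rh k kR by auto
      then have "q0 = h" using no qh by (metis le_trans nless_le)
      then have kR: "int k = R i" using q0 Rh by simp
      \<comment> \<open>The gain cannot reach \<open>k = R i\<close>, because \<open>R\<close> is at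
        least 1 at the witness; so the minimum is its second entry, which bounds
        \<open>S i\<close>.\<close>
      obtain s where s: "lo + 1 \<le> s" "s < i" "min (int k) (S (i - 1) - S (lo + 1)) \<le> R i - R s"
        using k(3) i unfolding rises_def by (metis le_add1)
      have "1 \<le> R s" using pos[of s] s i by auto
      then have Sk: "S i + 1 \<le> int k" using s kR Sd first_heights by auto
      then have "1 \<le> k - 1" using S1 by auto
      moreover have "rises R S lo i (int (k - 1))" using k(3) rises_mono by auto
      moreover have "drops R S N i (int (k - 1))"
      proof -
        obtain q1 where q1: "i < q1" "q1 \<le> h" "R q1 = R i - int (k - 1)"
          using height_path_first_level[OF path, of i h "R i - int (k - 1)"] i h Rh kR \<open>1 \<le> k - 1\<close> by force
        have "R q1 = 1" using q1 kR k(1) by auto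
        then have "q1 < h" using q1 Rh by (cases "q1 = h") auto
        have "S i - int (k - 1) < S t" if "i \<le> t" "t \<le> q1" for t
          using pos[of t] that i \<open>q1 < h\<close> Sk by auto
        then show ?thesis unfolding drops_def using q1 h by (intro exI[of _ q1]) auto
      qed
      ultimately show False using kmin[of "k - 1"] by auto
    qed
    then obtain q0 where q0: "i < q0" "q0 \<le> q" "q0 < h" "R q0 = R i - int k" by blast
    have "S' i - int k < S' t" if "i \<le> t" "t \<le> q0" for t
      using q(4)[rule_format, of t] that q0 b[of t] e i by auto
    then have "drops R' S' N i (int k)"
      unfolding drops_def using q0 h b[of q0] e i by (intro exI[of _ q0]) auto
    then show "\<exists>m\<ge>1. drops R' S' N i m \<and> rises R S lo i m" using k by (intro exI[of _ "int k"]) auto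
  qed
  then show ?thesis unfolding emits_def rises_before_hit[OF i]
    using e drops_before_hit_up[OF i] by auto
qed

lemma emits_hit:
  assumes "lo + 1 < i" "i \<le> N"
  shows "emits R' S' (lo + 1) N i \<longleftrightarrow> emits R S lo N i"
    and "emits S' R' (lo + 1) N i \<longleftrightarrow> emits S R lo N i"
  using assms emits_before_hit_R[of i] emits_before_hit_S[of i] emits_after_hit_R[of i]
    emits_after_hit_S[of i] emits_at_hit_R emits_at_hit_S
  by (metis linorder_neqE_nat)+

text \<open>At \<open>h\<close> the height \<open>R\<close> has lost the unit gained by the first
  \<open>A\<close> while \<open>S\<close> has not yet done so; hence the first position predicts the
  letter that is hit.\<close>

lemma emits_first:
  shows "emits R S lo N (lo + 1)" "\<not> emits S R lo N (lo + 1)"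
proof -
  have z: "R lo = 0" "S lo = 0" using path by (auto simp: height_path_def)
  have "S (lo + 1) - 1 < S t" if "lo + 1 \<le> t" "t \<le> h" for t
    using first_heights that pos[of t] Sh by (cases "t = h") auto
  then have "drops R S N (lo + 1) 1" unfolding drops_def
    using first_heights h Rh by (intro exI[of _ h]) auto
  then show "emits R S lo N (lo + 1)" unfolding emits_def using first_heights z by auto
  have "\<not> drops S R N (lo + 1) 1"
  proof
    assume "drops S R N (lo + 1) 1"
    then obtain q where q: "lo + 1 < q" "S q = 0" "\<forall>t. lo + 1 \<le> t \<and> t \<le> q \<longrightarrow> 0 < R t"
      unfolding drops_def using first_heights by auto
    have "h \<le> q" using q(1,2) pos[of q] by (cases "q < h") auto
    then show False using q(3)[rule_format, of h] first_heights Rh by auto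
  qed
  then show "\<not> emits S R lo N (lo + 1)" unfolding emits_def using first_heights z by auto
qed

end

lemma not_emits_first:
  assumes p: "height_path H G lo N" and pos: "\<And>t. lo < t \<Longrightarrow> t \<le> N \<Longrightarrow> 1 \<le> H t \<and> 1 \<le> G t" and "lo < N"
  shows "\<not> emits H G lo N (lo + 1)"
proof -
  have z: "H lo = 0" "G lo = 0" using p by (auto simp: height_path_def)
  have "\<not> drops H G N (lo + 1) 1" if "H (lo + 1) = 1"
  proof
    assume "drops H G N (lo + 1) 1"
    then obtain q where "lo + 1 < q" "q \<le> N" "H q = H (lo + 1) - 1" unfolding drops_def by blast
    then show False using that pos[of q] by auto
  qed
  then show ?thesis unfolding emits_def using z pos[of "lo + 1"] assms(3) by auto
qed

section \<open>Evacuation of words\<close>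

text \<open>Deleting the first letter renumbers the positions of a word, whereas
  \<open>promotion_hit\<close> keeps times; this and the next two lemmas translate between the
  conventions.\<close>

lemma drops_Suc: "drops (\<lambda>t. H (Suc t)) (\<lambda>t. G (Suc t)) N i m \<longleftrightarrow> drops H G (Suc N) (Suc i) m"
proof
  assume "drops (\<lambda>t. H (Suc t)) (\<lambda>t. G (Suc t)) N i m"
  then obtain q where q: "i < q" "q \<le> N" "H (Suc q) = H (Suc i) - m"
    "\<And>t. i \<le> t \<Longrightarrow> t \<le> q \<Longrightarrow> G (Suc i) - m < G (Suc t)" unfolding drops_def by blast
  have "G (Suc i) - m < G t" if "Suc i \<le> t" "t \<le> Suc q" for t
    using q(4)[of "t - 1"] that by (cases t) auto
  then show "drops H G (Suc N) (Suc i) m" unfolding drops_def using q by (intro exI[of _ "Suc q"]) auto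
next
  assume "drops H G (Suc N) (Suc i) m"
  then obtain q where q: "Suc i < q" "q \<le> Suc N" "H q = H (Suc i) - m"
    "\<And>t. Suc i \<le> t \<Longrightarrow> t \<le> q \<Longrightarrow> G (Suc i) - m < G t" unfolding drops_def by blast
  obtain r where r: "q = Suc r" using q(1) by (cases q) auto
  show "drops (\<lambda>t. H (Suc t)) (\<lambda>t. G (Suc t)) N i m"
    unfolding drops_def using q r by (intro exI[of _ r]) auto
qed

lemma rises_Suc:
  assumes "1 \<le> i"
  shows "rises (\<lambda>t. H (Suc t)) (\<lambda>t. G (Suc t)) lo i m \<longleftrightarrow> rises H G (Suc lo) (Suc i) m"
proof
  assume L: "rises (\<lambda>t. H (Suc t)) (\<lambda>t. G (Suc t)) lo i m"
  show "rises H G (Suc lo) (Suc i) m" unfolding rises_def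
  proof (intro allI impI)
    fix t assume t: "Suc lo \<le> t \<and> t < Suc i"
    then obtain r where r: "t = Suc r" by (cases t) auto
    then obtain s where "r \<le> s" "s < i" "min m (G (Suc (i - 1)) - G (Suc r)) \<le> H (Suc i) - H (Suc s)"
      using L t unfolding rises_def by auto
    then show "\<exists>s\<ge>t. s < Suc i \<and> min m (G (Suc i - 1) - G t) \<le> H (Suc i) - H s"
      using r assms by (intro exI[of _ "Suc s"]) auto
  qed
next
  assume L: "rises H G (Suc lo) (Suc i) m"
  show "rises (\<lambda>t. H (Suc t)) (\<lambda>t. G (Suc t)) lo i m" unfolding rises_def
  proof (intro allI impI)
    fix t assume t: "lo \<le> t \<and> t < i"
    then have "Suc lo \<le> Suc t \<and> Suc t < Suc i" by simp
    then obtain s where s: "Suc t \<le> s" "s < Suc i" "min m (G (Suc i - 1) - G (Suc t)) \<le> H (Suc i) - H s"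
      using L unfolding rises_def by blast
    obtain r where "s = Suc r" using s by (cases s) auto
    then show "\<exists>s\<ge>t. s < i \<and> min m (G (Suc (i - 1)) - G (Suc t)) \<le> H (Suc i) - H (Suc s)"
      using s assms by (intro exI[of _ r]) auto
  qed
qed

lemma emits_Suc:
  assumes "1 \<le> i"
  shows "emits (\<lambda>t. H (Suc t)) (\<lambda>t. G (Suc t)) lo N i \<longleftrightarrow> emits H G (Suc lo) (Suc N) (Suc i)"
  unfolding emits_def drops_Suc rises_Suc[OF assms] using assms by simp

section \<open>Heights of words and of their prefixes\<close>

definition height :: "letter \<Rightarrow> letter list \<Rightarrow> nat \<Rightarrow> int" where
  "height x u t = int (count_list (take t u) A) - int (count_list (take t u) x)"

text \<open>The prefix condition of \<open>kreweras\<close> freed from the letter counts, so that it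
  passes to prefixes. Heights are constant beyond the end of the word, hence the unbounded
  \<open>t\<close>.\<close>

definition dominant :: "letter list \<Rightarrow> bool" where
  "dominant u \<longleftrightarrow> (\<forall>t. 0 \<le> height B u t \<and> 0 \<le> height C u t)"

definition emitted :: "letter list \<Rightarrow> nat \<Rightarrow> letter" where
  "emitted u i = (if emits (height B u) (height C u) 0 (length u) i then B
     else if emits (height C u) (height B u) 0 (length u) i then C else A)"

lemma height_0 [simp]: "height x u 0 = 0"
  by (simp add: height_def)

lemma height_append:
  "height x (u @ v) t = height x u t + height x v (t - length u)"
  by (simp add: height_def)

lemma height_Cons_Suc:
  "height x (y # u) (Suc t) = (if y = A then 1 else 0) - (if y = x then 1 else 0) + height x u t"
  by (simp add: height_def)

lemma height_beyond: "length u \<le> t \<Longrightarrow> height x u t = height x u (length u)"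
  by (simp add: height_def)

lemma height_Suc:
  assumes "t < length u"
  shows "height x u (Suc t) = height x u t + (if u ! t = A then 1 else 0) - (if u ! t = x then 1 else 0)"
  using assms by (simp add: height_def take_Suc_conv_app_nth)

lemma kreweras_dominant:
  "kreweras n w \<longleftrightarrow> length w = 3 * n \<and> (\<forall>x. count_list w x = n) \<and> dominant w"
proof -
  have "(\<forall>k\<le>length w. count_list (take k w) B \<le> count_list (take k w) A \<and>
                     count_list (take k w) C \<le> count_list (take k w) A) \<longleftrightarrow> dominant w"
    unfolding dominant_def height_def
    by (metis (no_types, opaque_lifting) diff_ge_0_iff_ge linorder_linear of_nat_le_iff take_all order_refl)
  then show ?thesis by (simp add: kreweras_def)
qed

lemma dominant_take: "dominant (u @ v) \<Longrightarrow> dominant u"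
proof -
  assume d: "dominant (u @ v)"
  have "0 \<le> height B u t \<and> 0 \<le> height C u t" for t
  proof -
    have "height x u t = height x (u @ v) (min t (length u))" for x
      by (cases "t \<le> length u") (auto simp: height_append height_beyond[of u t] min_def)
    then show ?thesis using d unfolding dominant_def by simp
  qed
  then show "dominant u" by (simp add: dominant_def)
qed

lemma height_path_word:
  assumes "dominant u"
  shows "height_path (height B u) (height C u) 0 (length u)"
proof -
  have "height B u (Suc t) = height B u t + 1 \<and> height C u (Suc t) = height C u t + 1 \<or>
        height B u (Suc t) = height B u t - 1 \<and> height C u (Suc t) = height C u t \<or>
        height B u (Suc t) = height B u t \<and> height C u (Suc t) = height C u t - 1"
    if "t < length u" for t
    using height_Suc[OF that, of B] height_Suc[OF that, of C] by (cases "u ! t") auto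
  then show ?thesis using assms unfolding height_path_def dominant_def by simp
qed

section \<open>Toggles along a prefix\<close>

lemma dominant_swap:
  assumes "dominant (p @ a # b # s)"
  shows "dominant (p @ b # a # s) \<longleftrightarrow>
    0 \<le> height B (p @ [b]) (Suc (length p)) \<and> 0 \<le> height C (p @ [b]) (Suc (length p))"
proof -
  \<comment> \<open>Exchanging two neighbours affects only the prefix that ends between
    them.\<close>
  have "height x (p @ b # a # s) t =
      (if t = Suc (length p) then height x (p @ [b]) (Suc (length p)) else height x (p @ a # b # s) t)"
    if "x \<noteq> A" for x t
  proof (cases "t \<le> length p")
    case True then show ?thesis by (simp add: height_append)
  next
    case False
    then obtain d where d: "t = Suc (length p) + d" using le_Suc_ex[of "Suc (length p)" t] by auto
    show ?thesis
      by (cases d) (use that in \<open>simp_all add: d height_append height_Cons_Suc\<close>)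
  qed
  then show ?thesis using assms unfolding dominant_def by (metis letter.distinct(1,3))
qed

lemma kreweras_swap:
  assumes "kreweras n (p @ a # b # s)"
  shows "kreweras n (p @ b # a # s) \<longleftrightarrow>
    0 \<le> height B (p @ [b]) (Suc (length p)) \<and> 0 \<le> height C (p @ [b]) (Suc (length p))"
proof -
  have "count_list (p @ b # a # s) x = count_list (p @ a # b # s) x" for x by simp
  then show ?thesis
    using assms dominant_swap[of p a b s] unfolding kreweras_dominant by simp
qed

lemma swap_append: "swap (Suc (length p)) (p @ a # b # s) = p @ b # a # s"
  by (simp add: swap_def letter_at_def nth_append list_update_append)

lemma tau_append:
  assumes "kreweras n (p @ a # b # s)"
  shows "tau n (Suc (length p)) (p @ a # b # s) =
    (if 0 \<le> height B (p @ [b]) (Suc (length p)) \<and> 0 \<le> height C (p @ [b]) (Suc (length p))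
     then p @ b # a # s else p @ a # b # s)"
  unfolding tau_def swap_append kreweras_swap[OF assms] by simp

lemma kreweras_tau: "kreweras n w \<Longrightarrow> kreweras n (tau n i w)"
  by (simp add: tau_def)

text \<open>\<open>slide x y us\<close> is the result of pushing an \<^const>\<open>A\<close> standing in front of \<open>us\<close> to the right, where \<open>x\<close> and \<open>y\<close>
  are the heights reached by the letters to its left: the \<^const>\<open>A\<close> stays put at the first letter it cannot
  pass, and that letter then moves on to the end unhindered.\<close>

fun slide :: "int \<Rightarrow> int \<Rightarrow> letter list \<Rightarrow> letter list" where
  "slide x y [] = [A]"
| "slide x y (A # us) = A # slide (x + 1) (y + 1) us"
| "slide x y (B # us) = (if x = 0 then A # us @ [B] else B # slide (x - 1) y us)"
| "slide x y (C # us) = (if y = 0 then A # us @ [C] else C # slide x (y - 1) us)"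

text \<open>Every letter \<open>c\<close> may overtake \<open>b\<close>: the heights after
  \<open>p @ [c]\<close> are at least those after \<open>p @ [b, c]\<close>, because
  \<open>b\<close> cannot raise them.\<close>

lemma fold_tau_non_A:
  assumes "kreweras n (p @ b # us @ s)" "b \<noteq> A"
  shows "fold (tau n) [Suc (length p)..<Suc (length p + length us)] (p @ b # us @ s) = p @ us @ b # s"
  using assms
proof (induction us arbitrary: p)
  case (Cons c us)
  have d: "dominant (p @ b # c # us @ s)" using Cons.prems by (simp add: kreweras_dominant)
  have "0 \<le> height x (p @ [b, c]) (Suc (Suc (length p)))" if "x \<in> {B, C}" for x
    using d dominant_take[of "p @ [b, c]" "us @ s"] that unfolding dominant_def by auto
  moreover have "height x (p @ [b, c]) (Suc (Suc (length p))) \<le> height x (p @ [c]) (Suc (length p))" for x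
    using Cons.prems(2) by (simp add: height_def)
  ultimately have pos: "0 \<le> height x (p @ [c]) (Suc (length p))" if "x \<in> {B, C}" for x
    using that order_trans by blast
  have t: "tau n (Suc (length p)) (p @ b # c # us @ s) = p @ c # b # us @ s"
    using tau_append[of n p b c "us @ s"] Cons.prems pos by auto
  have k: "kreweras n ((p @ [c]) @ b # us @ s)"
    using kreweras_tau[of n "p @ b # c # us @ s" "Suc (length p)"] Cons.prems t by simp
  have "[Suc (length p)..<Suc (length p + length (c # us))] =
      Suc (length p) # [Suc (length (p @ [c]))..<Suc (length (p @ [c]) + length us)]"
    by (simp add: upt_rec)
  then show ?case using Cons.IH[OF k Cons.prems(2)] t by simp
qed simp

lemma fold_tau_slide:
  assumes "kreweras n (p @ A # us @ s)"
  shows "fold (tau n) [Suc (length p)..<Suc (length p + length us)] (p @ A # us @ s) =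
    p @ slide (height B p (length p)) (height C p (length p)) us @ s"
  using assms
proof (induction us arbitrary: p)
  case (Cons c us)
  let ?x = "height B p (length p)" and ?y = "height C p (length p)"
  have d: "dominant p" using Cons.prems dominant_take by (auto simp: kreweras_dominant)
  then have xy: "0 \<le> ?x" "0 \<le> ?y" unfolding dominant_def by auto
  have upt: "[Suc (length p)..<Suc (length p + length (c # us))] =
      Suc (length p) # [Suc (length (p @ [e]))..<Suc (length (p @ [e]) + length us)]" for e
    by (simp add: upt_rec)
  have h: "height x (p @ [c]) (Suc (length p)) =
      height x p (length p) + (if c = A then 1 else 0) - (if c = x then 1 else 0)" for x
    by (simp add: height_append height_Cons_Suc height_beyond[of p "Suc (length p)"])
  show ?case
  proof (cases "c = A \<or> c = B \<and> ?x \<noteq> 0 \<or> c = C \<and> ?y \<noteq> 0")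
    case True
    then have "0 \<le> height B (p @ [c]) (Suc (length p))" "0 \<le> height C (p @ [c]) (Suc (length p))"
      unfolding h using xy by auto
    then have t: "tau n (Suc (length p)) (p @ A # c # us @ s) = p @ c # A # us @ s"
      using tau_append[of n p A c "us @ s"] Cons.prems by auto
    have k: "kreweras n ((p @ [c]) @ A # us @ s)"
      using kreweras_tau[of n "p @ A # c # us @ s" "Suc (length p)"] Cons.prems t by simp
    have "slide ?x ?y (c # us) = c # slide (height B (p @ [c]) (Suc (length p))) (height C (p @ [c]) (Suc (length p))) us"
      unfolding h using True by (cases c) auto
    then show ?thesis using Cons.IH[OF k] t upt[of c] by simp
  next
    case False
    then have c: "c \<noteq> A" by auto
    have "\<not> (0 \<le> height B (p @ [c]) (Suc (length p)) \<and> 0 \<le> height C (p @ [c]) (Suc (length p)))"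
      unfolding h using False by (cases c) auto
    then have t: "tau n (Suc (length p)) (p @ A # c # us @ s) = p @ A # c # us @ s"
      using tau_append[of n p A c "us @ s"] Cons.prems by auto
    have sl: "slide ?x ?y (c # us) = A # us @ [c]" using False by (cases c) auto
    \<comment> \<open>After the refused swap the toggles continue with \<open>c\<close>, behind a
      prefix that now ends in \<open>A\<close>.\<close>
    have "kreweras n ((p @ [A]) @ c # us @ s)" using Cons.prems by simp
    from fold_tau_non_A[OF this c] show ?thesis using t sl upt[of A] by simp
  qed
qed simp

lemma partial_prom_slide:
  assumes "kreweras n (A # us @ s)"
  shows "partial_prom n (length us) (A # us @ s) = slide 0 0 us @ s"
  using fold_tau_slide[of n "[]" us s] assms by (simp add: partial_prom_def)

section \<open>One promotion step on words\<close>

lemma slide_cases: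
  obtains "slide x y us = us @ [A]"
      "\<And>t. t \<le> length us \<Longrightarrow> 0 \<le> x \<Longrightarrow> 0 \<le> y \<Longrightarrow> 0 \<le> x + height B us t \<and> 0 \<le> y + height C us t"
  | p b r where "us = p @ b # r" "slide x y us = p @ A # r @ [b]"
      "\<And>t. t \<le> length p \<Longrightarrow> 0 \<le> x \<Longrightarrow> 0 \<le> y \<Longrightarrow> 0 \<le> x + height B p t \<and> 0 \<le> y + height C p t"
      "b = B \<and> x + height B p (length p) = 0 \<or> b = C \<and> y + height C p (length p) = 0"
proof -
  have "(slide x y us = us @ [A] \<and>
      (\<forall>t\<le>length us. 0 \<le> x \<longrightarrow> 0 \<le> y \<longrightarrow> 0 \<le> x + height B us t \<and> 0 \<le> y + height C us t)) \<or>
    (\<exists>p b r. us = p @ b # r \<and> slide x y us = p @ A # r @ [b] \<and>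
      (\<forall>t\<le>length p. 0 \<le> x \<longrightarrow> 0 \<le> y \<longrightarrow> 0 \<le> x + height B p t \<and> 0 \<le> y + height C p t) \<and>
      (b = B \<and> x + height B p (length p) = 0 \<or> b = C \<and> y + height C p (length p) = 0))"
    (is "?P x y us \<or> ?Q x y us")
  proof (induction us arbitrary: x y)
    case (Cons c us)
    show ?case
    proof (cases "c = B \<and> x = 0 \<or> c = C \<and> y = 0")
      case True
      then have "?Q x y (c # us)"
        by (intro exI[of _ "[]"] exI[of _ c] exI[of _ us]) auto
      then show ?thesis by blast
    next
      case False
      define x' y' where "x' = x + height B [c] 1" and "y' = y + height C [c] 1"
      have xy: "0 \<le> x' \<and> 0 \<le> y'" if "0 \<le> x" "0 \<le> y"
        using False that by (cases c) (auto simp: x'_def y'_def height_def)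
      have sl: "slide x y (c # us) = c # slide x' y' us"
        using False by (cases c) (auto simp: x'_def y'_def height_def)
      have h: "x + height B (c # v) (Suc t) = x' + height B v t"
        "y + height C (c # v) (Suc t) = y' + height C v t" for v t
        by (simp_all add: x'_def y'_def height_def)
      from Cons.IH[of x' y'] show ?thesis
      proof
        assume P: "?P x' y' us"
        have "0 \<le> x + height B (c # us) t \<and> 0 \<le> y + height C (c # us) t"
          if "t \<le> length (c # us)" "0 \<le> x" "0 \<le> y" for t
          using P xy that h by (cases t) auto
        then show ?thesis using P sl by simp
      next
        assume "?Q x' y' us"
        then obtain p b r where Q: "us = p @ b # r" "slide x' y' us = p @ A # r @ [b]"
          "\<forall>t\<le>length p. 0 \<le> x' \<longrightarrow> 0 \<le> y' \<longrightarrow> 0 \<le> x' + height B p t \<and> 0 \<le> y' + height C p t"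
          "b = B \<and> x' + height B p (length p) = 0 \<or> b = C \<and> y' + height C p (length p) = 0" by blast
        have "0 \<le> x + height B (c # p) t \<and> 0 \<le> y + height C (c # p) t"
          if "t \<le> length (c # p)" "0 \<le> x" "0 \<le> y" for t
          using Q xy that h by (cases t) auto
        then have "?Q x y (c # us)" using Q sl h
          by (intro exI[of _ "c # p"] exI[of _ b] exI[of _ r]) auto
        then show ?thesis by blast
      qed
    qed
  qed auto
  then show thesis using that by blast
qed

text \<open>Transfer of the invariance to words: without a hit it is \<open>emits_no_hit\<close>,
  and a hit is an instance of \<open>promotion_hit\<close> whose \<open>R\<close> is the height
  belonging to the hit letter.\<close>

lemma emitted_slide:
  assumes d: "dominant (A # us)" and v: "v = slide 0 0 us"
  shows "last v = emitted (A # us) 1"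
    and "1 \<le> i \<Longrightarrow> i \<le> length us \<Longrightarrow> emitted (butlast v) i = emitted (A # us) (Suc i)"
proof -
  let ?u = "A # us" and ?N = "length (A # us)"
  define X where "X = height B ?u" define Y where "Y = height C ?u"
  \<comment> \<open>Delaying the shortened word by one time unit gives every surviving position its
    old number.\<close>
  define X' where "X' = (\<lambda>t. height B (butlast v) (t - 1))"
  define Y' where "Y' = (\<lambda>t. height C (butlast v) (t - 1))"
  have path: "height_path X Y 0 ?N" using height_path_word[OF d] by (simp add: X_def Y_def)
  have XS: "X (Suc t) = 1 + height B us t" "Y (Suc t) = 1 + height C us t" for t
    by (simp_all add: X_def Y_def height_Cons_Suc)
  have len: "length (butlast v) = length us"
    using slide_cases[of 0 0 us "length v = Suc (length us)"] v by auto
  have sh: "emits (height B (butlast v)) (height C (butlast v)) 0 (length us) i \<longleftrightarrow> emits X' Y' (0 + 1) ?N (Suc i)"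
    "emits (height C (butlast v)) (height B (butlast v)) 0 (length us) i \<longleftrightarrow> emits Y' X' (0 + 1) ?N (Suc i)"
    if "1 \<le> i" for i
    using emits_Suc[OF that, of X' Y' 0 "length us"] emits_Suc[OF that, of Y' X' 0 "length us"]
    by (simp_all add: X'_def Y'_def)
  have main: "last v = emitted ?u 1 \<and> (\<forall>i. 1 < i \<and> i \<le> ?N \<longrightarrow>
      emits X' Y' (0 + 1) ?N i = emits X Y 0 ?N i \<and> emits Y' X' (0 + 1) ?N i = emits Y X 0 ?N i)"
  proof (rule slide_cases[of 0 0 us])
    assume s: "slide 0 0 us = us @ [A]"
      "\<And>t. t \<le> length us \<Longrightarrow> 0 \<le> (0::int) \<Longrightarrow> 0 \<le> (0::int) \<Longrightarrow> 0 \<le> 0 + height B us t \<and> 0 \<le> 0 + height C us t"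
    have pos: "1 \<le> X t \<and> 1 \<le> Y t" if "0 < t" "t \<le> ?N" for t
      using s(2)[of "t - 1"] that XS[of "t - 1"] by auto
    have sh': "X' t = X t - 1 \<and> Y' t = Y t - 1" if "0 < t" "t \<le> ?N" for t
      using that XS[of "t - 1"] s(1) v by (auto simp: X'_def Y'_def)
    have "last v = emitted ?u 1"
      using not_emits_first[OF path] not_emits_first[OF height_path_sym[OF path]] pos v s(1)
      by (auto simp: emitted_def X_def Y_def)
    then show ?thesis
      using emits_no_hit[OF path, of X' Y'] emits_no_hit[OF height_path_sym[OF path], of Y' X'] pos sh' by auto
  next
    fix p b r
    assume us: "us = p @ b # r" and s: "slide 0 0 us = p @ A # r @ [b]"
      and pp: "\<And>t. t \<le> length p \<Longrightarrow> 0 \<le> (0::int) \<Longrightarrow> 0 \<le> (0::int) \<Longrightarrow> 0 \<le> 0 + height B p t \<and> 0 \<le> 0 + height C p t"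
      and b: "b = B \<and> 0 + height B p (length p) = 0 \<or> b = C \<and> 0 + height C p (length p) = 0"
    \<comment> \<open>The leading \<open>A\<close> and \<open>p\<close> precede \<open>b\<close> in
      \<open>A # us\<close>, and positions count from 1.\<close>
    define h where "h = Suc (Suc (length p))"
    have bl: "butlast v = p @ A # r" using v s by (simp add: butlast_append)
    have lv: "last v = b" using v s by simp
    have h: "0 < h" "h \<le> ?N" by (auto simp: h_def us)
    have low: "X t = 1 + height B p (t - 1)" "Y t = 1 + height C p (t - 1)" if "0 < t" "t < h" for t
      using that XS[of "t - 1"] by (auto simp: us h_def height_append)
    have pos: "1 \<le> X t \<and> 1 \<le> Y t" if "0 < t" "t < h" for t
      using low[OF that] pp[of "t - 1"] that by (auto simp: h_def)
    have before: "X' t = X t - 1 \<and> Y' t = Y t - 1" if "0 < t" "t < h" for t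
      using low[OF that] that by (auto simp: bl X'_def Y'_def height_append h_def)
    \<comment> \<open>The deleted \<open>A\<close> is compensated by the one replacing
      \<open>b\<close>, so the only net change is the loss of \<open>b\<close>.\<close>
    have after: "X' t = X t + (if b = B then 1 else 0) \<and> Y' t = Y t + (if b = C then 1 else 0)"
      if "h \<le> t" "t \<le> ?N" for t
    proof -
      obtain k where k: "t = h + k" using le_Suc_ex[OF \<open>h \<le> t\<close>] by blast
      have b': "b \<noteq> A" using b by auto
      have "height x us (t - 1) = height x p (t - 1) + height x (b # r) (Suc k)" for x
        by (simp add: k us height_append h_def)
      moreover have "height x (butlast v) (t - 1) = height x p (t - 1) + height x (A # r) (Suc k)" for x
        by (simp add: k bl height_append h_def)
      moreover have "Suc (t - 1) = t" using k by (simp add: h_def)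
      ultimately show ?thesis using XS[of "t - 1"] b'
        by (auto simp: X'_def Y'_def height_Cons_Suc)
    qed
    have hh: "height x p (Suc (length p)) = height x p (length p)" for x
      by (simp add: height_beyond[of p "Suc (length p)"])
    have Xh: "X h = 1 + height B p (length p) - (if b = B then 1 else 0)"
      "Y h = 1 + height C p (length p) - (if b = C then 1 else 0)"
      using XS[of "Suc (length p)"] b by (auto simp: h_def us height_append height_Cons_Suc hh)
    have ge: "0 \<le> height B p (length p)" "0 \<le> height C p (length p)" using pp[of "length p"] by auto
    from b show ?thesis
    proof
      assume B: "b = B \<and> 0 + height B p (length p) = 0"
      interpret promotion_hit X Y X' Y' 0 ?N h
        by unfold_locales (use path h pos before after B Xh ge in auto)
      have "emitted ?u 1 = B" using emits_first by (simp add: emitted_def X_def Y_def)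
      then show ?thesis using emits_hit lv B by simp
    next
      assume C: "b = C \<and> 0 + height C p (length p) = 0"
      interpret promotion_hit Y X Y' X' 0 ?N h
        by unfold_locales (use height_path_sym[OF path] h pos before after C Xh ge in auto)
      have "emitted ?u 1 = C" using emits_first by (simp add: emitted_def X_def Y_def)
      then show ?thesis using emits_hit lv C by simp
    qed
  qed
  then show "last v = emitted ?u 1" by blast
  show "emitted (butlast v) i = emitted ?u (Suc i)" if "1 \<le> i" "i \<le> length us"
    using main sh[OF that(1)] that unfolding emitted_def len by (simp add: X_def Y_def)
qed

text \<open>\<open>s\<close> collects the letters already emitted, which the remaining toggles do
  not touch. One promotion yields a Kreweras word \<open>v @ s\<close>; moving \<open>last v\<close>
  over to \<open>s\<close> leaves a shorter prefix for the induction.\<close>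

lemma evac_emitted_prefix:
  assumes "kreweras n (u @ s)" "length u = Suc k"
  shows "foldr (partial_prom n) [1..<Suc k] (u @ s) = map (emitted u) (rev [1..<Suc (length u)]) @ s"
  using assms
proof (induction k arbitrary: u s)
  case 0
  have d: "dominant u" using "0.prems" dominant_take by (auto simp: kreweras_dominant)
  obtain a where u: "u = [a]" using "0.prems"(2) by (cases u) auto
  have "0 \<le> height B u 1" "0 \<le> height C u 1" using d by (auto simp: dominant_def)
  then have "u = [A]" using u by (cases a) (auto simp: height_def)
  moreover have "last (slide 0 0 []) = emitted (A # []) 1"
    by (rule emitted_slide(1)) (use d \<open>u = [A]\<close> in auto)
  ultimately show ?case by simp
next
  case (Suc k)
  have d: "dominant u" using Suc.prems dominant_take by (auto simp: kreweras_dominant)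
  obtain a us where u: "u = a # us" and us: "length us = Suc k" using Suc.prems(2) by (cases u) auto
  have "0 \<le> height B u 1" "0 \<le> height C u 1" using d by (auto simp: dominant_def)
  then have a: "a = A" using u by (cases a) (auto simp: height_def)
  define v where "v = slide 0 0 us"
  have pp: "partial_prom n (Suc k) (u @ s) = v @ s"
    using partial_prom_slide[of n us s] Suc.prems u a us by (simp add: v_def)
  have "kreweras n (fold (tau n) l w)" if "kreweras n w" for l w
    using that by (induction l arbitrary: w) (auto simp: kreweras_tau)
  then have kv: "kreweras n (v @ s)" using Suc.prems(1) pp unfolding partial_prom_def by metis
  have lv: "length v = Suc (length us)"
    using slide_cases[of 0 0 us "length v = Suc (length us)"] by (auto simp: v_def)
  then have vne: "v \<noteq> []" by auto
  then have vs: "v @ s = butlast v @ (last v # s)" by simp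
  have "foldr (partial_prom n) [1..<Suc (Suc k)] (u @ s) = foldr (partial_prom n) [1..<Suc k] (v @ s)"
    using pp by simp
  also have "\<dots> = map (emitted (butlast v)) (rev [1..<Suc (length (butlast v))]) @ last v # s"
    unfolding vs by (rule Suc.IH) (use kv vs lv us in auto)
  also have "map (emitted (butlast v)) (rev [1..<Suc (length (butlast v))]) =
      map (emitted u) (rev [Suc 1..<Suc (length u)])"
  proof -
    have "[Suc 1..<Suc (length u)] = map Suc [1..<Suc (length (butlast v))]"
      using lv u by (simp add: map_Suc_upt)
    moreover have "emitted (butlast v) i = emitted u (Suc i)" if "i \<in> set [1..<Suc (length (butlast v))]" for i
      using emitted_slide(2)[of us v i] d u a v_def lv that by auto
    ultimately show ?thesis by (simp add: rev_map)
  qed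
  also have "last v = emitted u 1" using emitted_slide(1)[of us v] d u a v_def by simp
  finally show ?case by (simp add: upt_rec u)
qed

lemma evac_emitted:
  assumes "kreweras n w" "1 \<le> n"
  shows "evac n w = map (emitted w) (rev [1..<Suc (length w)])"
proof -
  have len: "length w = 3 * n" using assms by (simp add: kreweras_def)
  obtain k where k: "3 * n = Suc k" using assms by (cases "3 * n") auto
  then show ?thesis using evac_emitted_prefix[of n w "[]" k] assms len unfolding evac_def by (simp del: upt_Suc)
qed

section \<open>Matchings from heights\<close>

lemma last_level:
  fixes H :: "nat \<Rightarrow> int"
  assumes "j \<le> i" and "\<And>t. j \<le> t \<Longrightarrow> t < i \<Longrightarrow> H (Suc t) \<le> H t + 1"
    and "H j \<le> v" "v < H i"
  obtains r where "j \<le> r" "r < i" "H r = v" "\<And>t. r < t \<Longrightarrow> t \<le> i \<Longrightarrow> v < H t"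
proof -
  define S where "S = {t. j \<le> t \<and> t \<le> i \<and> H t \<le> v}"
  have S: "finite S" "j \<in> S" using assms by (auto simp: S_def)
  define r where "r = Max S"
  have "r \<in> S" unfolding r_def using Max_in[OF S(1)] S(2) by blast
  then have r: "j \<le> r" "r \<le> i" "H r \<le> v" by (auto simp: S_def)
  have lt: "v < H t" if "r < t" "t \<le> i" for t
  proof (rule ccontr)
    assume "\<not> v < H t"
    then have "t \<in> S" using that r by (auto simp: S_def)
    then show False using Max_ge[OF S(1), of t] that by (auto simp: r_def)
  qed
  have "r < i" using r assms(4) by (cases "r = i") auto
  then have "H r = v" using assms(2)[of r] r lt[of "Suc r"] by auto
  then show thesis using that r \<open>r < i\<close> lt by blast
qed

text \<open>The bracket matching of up and down steps. Position \<open>p\<close> is the step from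
  time \<open>p - 1\<close> to time \<open>p\<close>, so the arc spans an excursion above the level
  \<open>H (p - 1)\<close>.\<close>

definition height_arcs :: "(nat \<Rightarrow> int) \<Rightarrow> nat \<Rightarrow> arc set" where
  "height_arcs H N = {(p, q). 1 \<le> p \<and> p < q \<and> q \<le> N \<and> H q = H (p - 1) \<and>
     (\<forall>t. p \<le> t \<and> t < q \<longrightarrow> H (p - 1) < H t)}"

locale excursion =
  fixes H :: "nat \<Rightarrow> int" and N :: nat
  assumes zero: "H 0 = 0" "H N = 0" and ge0: "\<And>t. 0 \<le> H t"
    and steps: "\<And>t. t < N \<Longrightarrow> H t - 1 \<le> H (Suc t) \<and> H (Suc t) \<le> H t + 1"
begin

lemma arcD:
  assumes "(p, q) \<in> height_arcs H N"
  shows "1 \<le> p" "p < q" "q \<le> N" "H q = H (p - 1)" "\<And>t. p \<le> t \<Longrightarrow> t < q \<Longrightarrow> H q < H t"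
  using assms by (auto simp: height_arcs_def)

lemma arc_fst_up: "(p, q) \<in> height_arcs H N \<Longrightarrow> H p = H (p - 1) + 1"
  using arcD[of p q] steps[of "p - 1"] by fastforce

lemma arc_snd_down: "(p, q) \<in> height_arcs H N \<Longrightarrow> H q = H (q - 1) - 1"
  using arcD(1-4)[of p q] arcD(5)[of p q "q - 1"] steps[of "q - 1"] by fastforce

text \<open>Time \<open>p' - 1\<close> lies under the first arc, so the second arc sits at a
  strictly higher level, which excludes a common right end; if it ended later, \<open>q\<close>
  would lie under it and the levels would also compare the other way.\<close>

lemma arc_noncrossing:
  assumes "(p, q) \<in> height_arcs H N" "(p', q') \<in> height_arcs H N" "p < p'" "p' < q"
  shows "q' < q"
proof (rule ccontr)
  assume "\<not> q' < q"
  have p': "p \<le> p' - 1" "p' - 1 < q" "p' \<le> q" using assms by auto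
  from \<open>\<not> q' < q\<close> consider "q = q'" | "q < q'" by linarith
  then show False
  proof cases
    case 1
    then show ?thesis using arcD(4)[OF assms(2)] arcD(5)[OF assms(1) p'(1,2)] by simp
  next
    case 2
    then show ?thesis using arcD(4)[OF assms(2)] arcD(5)[OF assms(1) p'(1,2)] arcD(5)[OF assms(2) p'(3) 2] by simp
  qed
qed

lemma arc_fst_inj:
  assumes "(p, q) \<in> height_arcs H N" "(p, q') \<in> height_arcs H N"
  shows "q = q'"
  using arcD[OF assms(1)] arcD[OF assms(2)]
  by (metis linorder_neqE_nat less_imp_le order_less_irrefl)

lemma arc_snd_inj:
  assumes "(p, q) \<in> height_arcs H N" "(p', q) \<in> height_arcs H N"
  shows "p = p'"
  using arc_noncrossing[OF assms(1,2)] arc_noncrossing[OF assms(2,1)] arcD(2)[OF assms(1)] arcD(2)[OF assms(2)]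
  by (metis linorder_neqE_nat order_less_irrefl)

lemma arc_fst_ne_snd:
  assumes "(p, q) \<in> height_arcs H N" "(p', q') \<in> height_arcs H N"
  shows "p \<noteq> q'"
  using arc_fst_up[OF assms(1)] arc_snd_down[OF assms(2)] by auto

text \<open>The last visit to the level before \<open>i\<close> and the first one after
  \<open>i\<close> bound an excursion over \<open>i\<close>; the arc opens one step after that last
  visit.\<close>

lemma level_arc_ex:
  assumes i: "i \<le> N" and k: "1 \<le> k" "k \<le> H i"
  obtains p q where "(p, q) \<in> height_arcs H N" "p \<le> i" "i < q" "H q = H i - k"
proof -
  obtain q where q: "i < q" "q \<le> N" "H q = H i - k" "\<And>t. i \<le> t \<Longrightarrow> t < q \<Longrightarrow> H i - k < H t"
    by (rule first_level[of i N H "H i - k"]) (use steps zero k i in auto)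
  obtain r where r: "r < i" "H r = H i - k" "\<And>t. r < t \<Longrightarrow> t \<le> i \<Longrightarrow> H i - k < H t"
    by (rule last_level[of 0 i H "H i - k"]) (use steps zero k i in auto)
  have "H i - k < H t" if "Suc r \<le> t" "t < q" for t
    using r(3)[of t] q(4)[of t] that by (cases "t \<le> i") auto
  then have "(Suc r, q) \<in> height_arcs H N" using q r by (auto simp: height_arcs_def)
  then show thesis using that[of "Suc r" q] r q by auto
qed

lemma arc_from_up:
  assumes "1 \<le> p" "p \<le> N" "H p = H (p - 1) + 1"
  obtains q where "(p, q) \<in> height_arcs H N"
proof -
  obtain q where "p < q" "q \<le> N" "H q = H (p - 1)" "\<And>t. p \<le> t \<Longrightarrow> t < q \<Longrightarrow> H (p - 1) < H t"
    by (rule first_level[of p N H "H (p - 1)"]) (use steps zero assms ge0[of "p - 1"] in auto)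
  then show thesis using that[of q] assms by (auto simp: height_arcs_def)
qed

lemma arc_to_down:
  assumes "1 \<le> q" "q \<le> N" "H q = H (q - 1) - 1"
  obtains p where "(p, q) \<in> height_arcs H N"
proof -
  obtain r where r: "r < q - 1" "H r = H q" "\<And>t. r < t \<Longrightarrow> t \<le> q - 1 \<Longrightarrow> H q < H t"
    by (rule last_level[of 0 "q - 1" H "H q"]) (use steps zero assms ge0[of q] in auto)
  then have "(Suc r, q) \<in> height_arcs H N" using assms by (auto simp: height_arcs_def)
  then show thesis using that by blast
qed

end

section \<open>The noncrossing matchings of a Kreweras word\<close>

lemma letter_height:
  assumes "1 \<le> i" "i \<le> length w"
  shows "height x w i = height x w (i - 1) + (if letter_at w i = A then 1 else 0) - (if letter_at w i = x then 1 else 0)"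
  using height_Suc[of "i - 1" w x] assms by (simp add: letter_at_def)

lemma kreweras_excursion:
  assumes "kreweras n w" "x \<in> {B, C}"
  shows "excursion (height x w) (length w)"
proof
  show "height x w 0 = 0" by simp
  show "height x w (length w) = 0" using assms by (simp add: height_def kreweras_def)
  show "0 \<le> height x w t" for t using assms by (auto simp: kreweras_dominant dominant_def)
  show "height x w t - 1 \<le> height x w (Suc t) \<and> height x w (Suc t) \<le> height x w t + 1" if "t < length w" for t
    using height_Suc[OF that, of x] by simp
qed

lemma noncrossing_height_arcs:
  assumes "kreweras n w" "x \<in> {B, C}"
  shows "noncrossing_matching w x (height_arcs (height x w) (length w))"
proof -
  interpret excursion "height x w" "length w" using kreweras_excursion[OF assms] .
  have x: "x \<noteq> A" using assms by auto
  have up: "height x w i = height x w (i - 1) + 1 \<longleftrightarrow> letter_at w i = A"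
    and down: "height x w i = height x w (i - 1) - 1 \<longleftrightarrow> letter_at w i = x"
    if "1 \<le> i" "i \<le> length w" for i
    using letter_height[OF that, of x] x by auto
  show ?thesis unfolding noncrossing_matching_def
  proof (intro conjI ballI impI)
    fix e assume e: "e \<in> height_arcs (height x w) (length w)"
    obtain i j where [simp]: "e = (i, j)" by (cases e)
    have e': "(i, j) \<in> height_arcs (height x w) (length w)" using e by simp
    show "case e of (i, j) \<Rightarrow> 1 \<le> i \<and> i < j \<and> j \<le> length w \<and> letter_at w i = A \<and> letter_at w j = x"
      using arcD(1-3)[OF e'] up[of i] down[of j] arc_fst_up[OF e'] arc_snd_down[OF e'] by auto
    show "case e of (i, j) \<Rightarrow> \<forall>(k, l) \<in> height_arcs (height x w) (length w). \<not> (i < k \<and> k < j \<and> j < l)"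
      using arc_noncrossing[OF e'] by fastforce
  next
    fix k assume k: "k \<in> {1..length w}" and l: "letter_at w k \<in> {A, x}"
    show "\<exists>!e. e \<in> height_arcs (height x w) (length w) \<and> (fst e = k \<or> snd e = k)"
    proof (cases "letter_at w k = A")
      case True
      then obtain q where q: "(k, q) \<in> height_arcs (height x w) (length w)"
        using arc_from_up[of k] up[of k] k by auto
      show ?thesis
      proof (rule ex1I[of _ "(k, q)"])
        fix e assume e: "e \<in> height_arcs (height x w) (length w) \<and> (fst e = k \<or> snd e = k)"
        then show "e = (k, q)" using arc_fst_inj[OF q] arc_fst_ne_snd[OF q] by (cases e) auto
      qed (use q in auto)
    next
      case False
      then obtain p where p: "(p, k) \<in> height_arcs (height x w) (length w)"
        using arc_to_down[of k] down[of k] k l by auto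
      show ?thesis
      proof (rule ex1I[of _ "(p, k)"])
        fix e assume e: "e \<in> height_arcs (height x w) (length w) \<and> (fst e = k \<or> snd e = k)"
        then show "e = (p, k)" using arc_snd_inj[OF p] arc_fst_ne_snd[OF _ p] by (cases e) auto
      qed (use p in auto)
    qed
  qed
qed

text \<open>Induction on the length of an arc of \<open>M\<close>: the arcs of \<open>M\<close>
  under it are shorter, hence already known to be arcs of the path, and this keeps the path above
  the level of the arc. Equality follows because \<open>M\<close> has an arc at every
  \<open>A\<close>.\<close>

lemma noncrossing_matching_unique:
  assumes "kreweras n w" "x \<in> {B, C}" and M: "noncrossing_matching w x M"
  shows "M = height_arcs (height x w) (length w)" (is "M = ?M")
proof -
  interpret excursion "height x w" "length w" using kreweras_excursion[OF assms(1,2)] .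
  have x: "x \<noteq> A" using assms by auto
  have M': "noncrossing_matching w x ?M" using noncrossing_height_arcs[OF assms(1,2)] .
  have ends: "1 \<le> i" "i < j" "j \<le> length w" "letter_at w i = A" "letter_at w j = x"
    if "(i, j) \<in> M" for i j using M that unfolding noncrossing_matching_def by auto
  have ends': "letter_at w i = A" "letter_at w j = x" if "(i, j) \<in> ?M" for i j
    using M' that unfolding noncrossing_matching_def by auto
  have perfect: "\<exists>!e. e \<in> M \<and> (fst e = k \<or> snd e = k)"
    if "1 \<le> k" "k \<le> length w" "letter_at w k \<in> {A, x}" for k
  proof -
    have "k \<in> {1..length w}" using that by simp
    from bspec[OF M[unfolded noncrossing_matching_def, THEN conjunct2, THEN conjunct1] this] that(3)
    show ?thesis by (rule mp)
  qed
  have uniq: "e = f" if "e \<in> M" "f \<in> M" "fst e = k \<or> snd e = k" "fst f = k \<or> snd f = k"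
    "1 \<le> k" "k \<le> length w" "letter_at w k \<in> {A, x}" for e f k
    using perfect[OF that(5-7)] that(1-4) by blast
  have from_A: "\<exists>q. (k, q) \<in> M" if "1 \<le> k" "k \<le> length w" "letter_at w k = A" for k
  proof -
    have "letter_at w k \<in> {A, x}" using that by simp
    note ex = perfect[OF that(1,2) this]
    obtain e where "e \<in> M" "fst e = k \<or> snd e = k" using ex by blast
    then show ?thesis using ends(5)[of "fst e" "snd e"] that x by (cases e) auto
  qed
  have to_x: "\<exists>p. (p, k) \<in> M" if "1 \<le> k" "k \<le> length w" "letter_at w k = x" for k
  proof -
    have "letter_at w k \<in> {A, x}" using that by simp
    note ex = perfect[OF that(1,2) this]
    obtain e where "e \<in> M" "fst e = k \<or> snd e = k" using ex by blast
    then show ?thesis using ends(4)[of "fst e" "snd e"] that x by (cases e) auto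
  qed
  have nc: "\<not> (i < k \<and> k < j \<and> j < l)" if "(i, j) \<in> M" "(k, l) \<in> M" for i j k l
    using bspec[OF M[unfolded noncrossing_matching_def, THEN conjunct2, THEN conjunct2] that(1)] that(2)
    by fastforce
  have sub: "(i, j) \<in> M \<Longrightarrow> (i, j) \<in> ?M" for i j
  proof (induction "j - i" arbitrary: i j rule: less_induct)
    case less
    note e = ends[OF less.prems]
    let ?H = "height x w"
    have above: "?H (i - 1) < ?H t" if "i \<le> t" "t < j" for t
      using that
    proof (induction t rule: less_induct)
      case (less t)
      have t: "1 \<le> t" "t \<le> length w" using less.prems e by auto
      show ?case
      proof (cases "t = i")
        case True then show ?thesis using letter_height[OF t, of x] e x by auto
      next
        case ti: False
        have prev: "?H (i - 1) < ?H (t - 1)" using less.IH[of "t - 1"] ti less.prems by auto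
        show ?thesis
        proof (cases "letter_at w t = x")
          case False then show ?thesis using letter_height[OF t, of x] prev by auto
        next
          case True
          \<comment> \<open>A closing letter under the arc is also opened under it, by noncrossing,
            so it brings the path back only to a level already taken inside.\<close>
          obtain p where p: "(p, t) \<in> M" using to_x[OF t True] by blast
          note ep = ends[OF p]
          have "p \<noteq> i" using uniq[OF p \<open>(i, j) \<in> M\<close>, of i] e less.prems by auto
          moreover have "\<not> p < i" using nc[OF p \<open>(i, j) \<in> M\<close>] less.prems ti by auto
          ultimately have pi: "i < p" by simp
          have "(p, t) \<in> ?M"
            using \<open>\<And>j' i'. j' - i' < j - i \<Longrightarrow> (i', j') \<in> M \<Longrightarrow> (i', j') \<in> ?M\<close> p ep pi less.prems by auto
          then have "?H t = ?H (p - 1)" using arcD(4) by blast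
          moreover have "?H (i - 1) < ?H (p - 1)" using less.IH[of "p - 1"] pi ep less.prems by auto
          ultimately show ?thesis by simp
        qed
      qed
    qed
    have j1: "?H j = ?H (j - 1) - 1" using letter_height[of j w x] e x by auto
    obtain p where p: "(p, j) \<in> ?M" using arc_to_down[of j] e j1 by auto
    have "\<not> p < i"
    proof
      assume "p < i"
      then have "?H j < ?H (i - 1)" using arcD(5)[OF p, of "i - 1"] e by auto
      moreover have "?H (i - 1) < ?H (j - 1)" using above[of "j - 1"] e by auto
      ultimately show False using j1 by auto
    qed
    moreover have "\<not> i < p"
    proof
      assume ip: "i < p"
      note dp = arcD(1-3)[OF p]
      obtain q where q: "(p, q) \<in> M" using from_A[of p] dp ends'(1)[OF p] by auto
      have "q \<noteq> j" using uniq[OF q less.prems, of j] e ip by auto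
      moreover have "\<not> j < q" using nc[OF less.prems q] ip dp by auto
      ultimately have "q < j" by simp
      then have "(p, q) \<in> ?M" using less.hyps[of q p] q ip ends(2)[OF q] by auto
      then show False using arc_fst_inj[OF p] \<open>q \<noteq> j\<close> by blast
    qed
    ultimately show ?case using p by (cases "p = i") auto
  qed
  have "(i, j) \<in> M" if "(i, j) \<in> ?M" for i j
  proof -
    have "\<exists>q. (i, q) \<in> M" using from_A[of i] arcD(1-3)[OF that] ends'(1)[OF that] by auto
    then obtain q where q: "(i, q) \<in> M" by blast
    then show ?thesis using arc_fst_inj[OF that] sub[OF q] by simp
  qed
  then show ?thesis using sub by auto
qed

lemma kmatching_height_arcs:
  assumes "kreweras n w" "x \<in> {B, C}"
  shows "kmatching w x = height_arcs (height x w) (length w)"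
  unfolding kmatching_def
  using noncrossing_height_arcs[OF assms] noncrossing_matching_unique[OF assms] by (rule the_equality)

section \<open>Crossings on an arc\<close>

lemma crossing_bounds:
  assumes "crosses (a, b) (c, d)" "z \<in> semicircle (a, b)" "z \<in> semicircle (c, d)"
  shows "real c \<le> Re z" "Re z < real b" "a < c \<Longrightarrow> real c < Re z" "a = c \<Longrightarrow> Re z = real c"
proof -
  have o: "a \<le> c" "c < b" "b < d" using assms(1) by (auto simp: crosses_def)
  have eq: "(Re z - real a) * (real b - Re z) = (Re z - real c) * (real d - Re z)"
    using assms o semicircle_iff[of a b z] semicircle_iff[of c d z] by auto
  show c: "real c \<le> Re z" using semicircle_Re_bounds[of c d z] assms o by auto
  have "Re z \<le> real b" using semicircle_Re_bounds[of a b z] assms o by auto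
  moreover have "Re z \<noteq> real b" using eq o by auto
  ultimately show "Re z < real b" by simp
  show "real c < Re z" if "a < c"
  proof -
    have "Re z \<noteq> real c" using eq o that by auto
    then show ?thesis using c by simp
  qed
  show "Re z = real c" if "a = c"
  proof (rule ccontr)
    assume "Re z \<noteq> real c"
    then have "real b - Re z = real d - Re z" using eq that by simp
    then show False using o by simp
  qed
qed

text \<open>The difference of two functions \<open>(x - u) * (v - x)\<close> is linear in
  \<open>x\<close>. For \<open>(a, b)\<close> and the outer arc \<open>(c1, d1)\<close> it decreases
  and vanishes at \<open>Re z1\<close>; it is negative at \<open>Re z2\<close>, because there the
  outer semicircle lies above the inner one, which passes through \<open>z2\<close>.\<close>

lemma crossing_order_right:
  assumes "crosses (a, b) (c1, d1)" "c1 < c2" "crosses (a, b) (c2, d2)" "d2 < d1"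
    and "z1 \<in> semicircle (a, b)" "z1 \<in> semicircle (c1, d1)"
    and "z2 \<in> semicircle (a, b)" "z2 \<in> semicircle (c2, d2)"
  shows "Re z1 < Re z2"
proof -
  have o: "a \<le> c1" "c1 < b" "b < d1" "c2 < b" "b < d2" using assms by (auto simp: crosses_def)
  let ?x1 = "Re z1" and ?x2 = "Re z2"
  have eq1: "(?x1 - real a) * (real b - ?x1) = (?x1 - real c1) * (real d1 - ?x1)"
    using assms o semicircle_iff[of a b z1] semicircle_iff[of c1 d1 z1] by auto
  have eq2: "(?x2 - real a) * (real b - ?x2) = (?x2 - real c2) * (real d2 - ?x2)"
    using assms o semicircle_iff[of a b z2] semicircle_iff[of c2 d2 z2] by auto
  have b: "real c2 \<le> ?x2" "?x2 < real b" using crossing_bounds[OF assms(3,7,8)] by auto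
  have "(?x2 - real c2) * (real d2 - ?x2) < (?x2 - real c1) * (real d1 - ?x2)"
    using b o assms(2,4) by (intro mult_strict_mono') auto
  then have "(?x2 - real a) * (real b - ?x2) - (?x2 - real c1) * (real d1 - ?x2) <
      (?x1 - real a) * (real b - ?x1) - (?x1 - real c1) * (real d1 - ?x1)"
    using eq1 eq2 by simp
  then have "0 < (real c1 - real a + (real d1 - real b)) * (?x2 - ?x1)"
    by (simp add: algebra_simps)
  moreover have "0 < real c1 - real a + (real d1 - real b)" using o by simp
  ultimately show ?thesis by (simp add: zero_less_mult_iff)
qed

text \<open>Mirror image of the previous argument: the outer arc is now \<open>(c2, d2)\<close>, and
  the linear function increases.\<close>

lemma crossing_order_left:
  assumes "crosses (c1, d1) (a, b)" "c2 < c1" "crosses (c2, d2) (a, b)" "d1 < d2"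
    and "z1 \<in> semicircle (a, b)" "z1 \<in> semicircle (c1, d1)"
    and "z2 \<in> semicircle (a, b)" "z2 \<in> semicircle (c2, d2)"
  shows "Re z1 < Re z2"
proof -
  have o: "c1 \<le> a" "a < d1" "d1 < b" "c2 \<le> a" "a < d2" "d2 < b" using assms by (auto simp: crosses_def)
  let ?x1 = "Re z1" and ?x2 = "Re z2"
  have eq1: "(?x1 - real a) * (real b - ?x1) = (?x1 - real c1) * (real d1 - ?x1)"
    using assms o semicircle_iff[of a b z1] semicircle_iff[of c1 d1 z1] by auto
  have eq2: "(?x2 - real a) * (real b - ?x2) = (?x2 - real c2) * (real d2 - ?x2)"
    using assms o semicircle_iff[of a b z2] semicircle_iff[of c2 d2 z2] by auto
  have b: "real a \<le> ?x1" "?x1 < real d1" using crossing_bounds[OF assms(1,6,5)] by auto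
  have "(?x1 - real c1) * (real d1 - ?x1) < (?x1 - real c2) * (real d2 - ?x1)"
    using b o assms(2,4) by (intro mult_strict_mono') auto
  then have "(?x1 - real a) * (real b - ?x1) - (?x1 - real c2) * (real d2 - ?x1) <
      (?x2 - real a) * (real b - ?x2) - (?x2 - real c2) * (real d2 - ?x2)"
    using eq1 eq2 by simp
  then have "0 < (real a - real c2 + (real b - real d2)) * (?x2 - ?x1)"
    by (simp add: algebra_simps)
  moreover have "0 < real a - real c2 + (real b - real d2)" using o by simp
  ultimately show ?thesis by (simp add: zero_less_mult_iff)
qed

text \<open>The arcs crossing a fixed arc \<open>e\<close> meet it in the order of their endpoints lying under \<open>e\<close>.\<close>

definition inner_end :: "arc \<Rightarrow> arc \<Rightarrow> nat" where
  "inner_end e f = (if crosses e f then fst f else snd f)"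

section \<open>Two matchings on one path\<close>

locale two_matchings =
  fixes H K :: "nat \<Rightarrow> int" and N :: nat and w :: "letter list"
  assumes excH: "excursion H N" and excK: "excursion K N" and pathHK: "height_path H K 0 N"
    and arcs_eq: "arcs w = height_arcs H N \<union> height_arcs K N"
begin

lemma swapped: "two_matchings K H N w"
  using excH excK height_path_sym[OF pathHK] arcs_eq by (simp add: two_matchings_def Un_commute)

sublocale E: excursion H N by (rule excH)
sublocale F: excursion K N by (rule excK)

abbreviation "E \<equiv> height_arcs H N"
abbreviation "F \<equiv> height_arcs K N"

text \<open>Each step raises both heights or lowers exactly one, so arcs of different matchings can
  share only a left end.\<close>

lemma ends_distinct:
  assumes "(a, b) \<in> E" "(c, d) \<in> F"
  shows "a \<noteq> d" "b \<noteq> d" "b \<noteq> c"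
proof -
  note 1 = E.arcD(1-3)[OF assms(1)] F.arcD(1-3)[OF assms(2)]
  have "a \<le> N" "c \<le> N" "0 < a" "0 < b" "0 < c" "0 < d" using 1 by auto
  then show "a \<noteq> d" "b \<noteq> d" "b \<noteq> c"
    using E.arc_fst_up[OF assms(1)] E.arc_snd_down[OF assms(1)] F.arc_fst_up[OF assms(2)] F.arc_snd_down[OF assms(2)]
      height_path_step[OF pathHK, of a] height_path_step[OF pathHK, of b] height_path_step[OF pathHK, of c] 1
    by fastforce+
qed

lemma not_crosses_same:
  assumes "e \<in> E" "f \<in> E"
  shows "\<not> crosses e f"
proof
  assume c: "crosses e f"
  obtain a b c' d where [simp]: "e = (a, b)" "f = (c', d)" by (cases e, cases f)
  show False
    using c assms E.arc_noncrossing[of a b c' d] E.arc_fst_inj[of a b d]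
    by (cases "a = c'") (auto simp: crosses_def)
qed

lemma meeting_iff:
  assumes "e \<in> E"
  shows "meeting w e f z \<longleftrightarrow> f \<in> F \<and> (crosses e f \<or> crosses f e) \<and> z \<in> semicircle e \<and> z \<in> semicircle f"
  using not_crosses_same[OF assms] not_crosses_same[OF _ assms] unfolding meeting_def arcs_eq by blast

text \<open>Otherwise \<open>f\<close> and \<open>g\<close>, which belong to the same matching,
  would cross or share their left end. So along \<open>e\<close> the arcs that close under it are
  met before those that open under it.\<close>

lemma right_not_before_left:
  assumes "e \<in> E" "f \<in> F" "g \<in> F" "crosses e f" "crosses g e"
  shows "snd g < fst f"
proof -
  obtain a b c d c' d' where [simp]: "e = (a, b)" "f = (c, d)" "g = (c', d')" by (cases e, cases f, cases g)
  have o: "a \<le> c" "c < b" "b < d" "c' \<le> a" "a < d'" "d' < b" using assms by (auto simp: crosses_def)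
  show ?thesis
  proof (rule ccontr)
    assume "\<not> snd g < fst f"
    then have "c < d'" using F.arc_fst_ne_snd[of c d c' d'] assms by auto
    then show False
      using o F.arc_noncrossing[of c' d' c d] F.arc_fst_inj[of c d d'] assms by (cases "c' = c") auto
  qed
qed

lemma inner_end_inj:
  assumes "e \<in> E" "f \<in> F" "g \<in> F" "crosses e f \<or> crosses f e" "crosses e g \<or> crosses g e"
    and "inner_end e f = inner_end e g"
  shows "f = g"
proof -
  obtain c d c' d' where [simp]: "f = (c, d)" "g = (c', d')" by (cases f, cases g)
  show ?thesis
    using assms F.arc_fst_inj[of c d d'] F.arc_snd_inj[of c d c'] F.arc_fst_ne_snd[of c d c' d'] F.arc_fst_ne_snd[of c' d' c d]
    by (auto simp: inner_end_def split: if_splits)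
qed

text \<open>Two arcs that cross \<open>e\<close> on the same side are nested, as
  \<open>crossing_order_right\<close> and \<open>crossing_order_left\<close> require; arcs on
  different sides are separated by \<open>right_not_before_left\<close>.\<close>

lemma crossing_order:
  assumes e: "e \<in> E" and "f \<in> F" "g \<in> F" "crosses e f \<or> crosses f e" "crosses e g \<or> crosses g e"
    and z: "z1 \<in> semicircle e" "z1 \<in> semicircle f" "z2 \<in> semicircle e" "z2 \<in> semicircle g"
    and lt: "inner_end e f < inner_end e g"
  shows "Re z1 < Re z2"
proof -
  obtain a b c d c' d' where [simp]: "e = (a, b)" "f = (c, d)" "g = (c', d')" by (cases e, cases f, cases g)
  have excl: "\<not> (crosses x y \<and> crosses y x)" for x y by (auto simp: crosses_def)
  consider "crosses e f" "crosses e g" | "crosses f e" "crosses g e"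
    | "crosses f e" "crosses e g" | "crosses e f" "crosses g e" using assms(4,5) by blast
  then show ?thesis
  proof cases
    case 1
    then have "c < c'" using lt by (simp add: inner_end_def)
    moreover have "d' < d"
      using F.arc_noncrossing[of c d c' d'] calculation assms 1 by (auto simp: crosses_def)
    ultimately show ?thesis using crossing_order_right[of a b c d c' d' z1 z2] 1 z by simp
  next
    case 2
    then have dd: "d < d'" using lt excl by (auto simp: inner_end_def)
    moreover have "c' < c"
      using F.arc_noncrossing[of c d c' d'] F.arc_fst_inj[of c d d'] dd assms 2 
      by (cases c c' rule: linorder_cases) (auto simp: crosses_def)
    ultimately show ?thesis using crossing_order_left[of c d a b c' d' z1 z2] 2 z by simp
  next
    case 3
    have "d < c'" using right_not_before_left[OF e assms(3,2)] 3 by simp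
    moreover have "Re z1 < real d" using crossing_bounds(2)[of c d a b z1] 3 z by simp
    moreover have "real c' \<le> Re z2" using crossing_bounds(1)[of a b c' d' z2] 3 z by simp
    ultimately show ?thesis by simp
  next
    case 4
    then show ?thesis using right_not_before_left[OF e assms(2,3)] lt excl by (auto simp: inner_end_def)
  qed
qed

lemma crossing_order_iff:
  assumes e: "e \<in> E" and "f \<in> F" "g \<in> F" "crosses e f \<or> crosses f e" "crosses e g \<or> crosses g e"
    and z: "z1 \<in> semicircle e" "z1 \<in> semicircle f" "z2 \<in> semicircle e" "z2 \<in> semicircle g"
  shows "Re z1 < Re z2 \<longleftrightarrow> inner_end e f < inner_end e g"
proof (cases "inner_end e f" "inner_end e g" rule: linorder_cases)
  case less then show ?thesis using crossing_order[OF assms] by simp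
next
  case equal
  then have "f = g" using inner_end_inj[OF assms(1-5)] by simp
  then have "z1 = z2" using semicircles_meet_once[OF assms(4)] z by blast
  then show ?thesis using equal by simp
next
  case greater
  then show ?thesis using crossing_order[OF e assms(3,2,5,4) z(3,4,1,2)] by simp
qed

lemma next_meeting_unique:
  assumes e: "e \<in> E" and 1: "next_meeting w e h p f z" and 2: "next_meeting w e h p g y"
  shows "f = g \<and> z = y"
proof -
  have f: "f \<in> F" "crosses e f \<or> crosses f e" "z \<in> semicircle e" "z \<in> semicircle f"
    and g: "g \<in> F" "crosses e g \<or> crosses g e" "y \<in> semicircle e" "y \<in> semicircle g"
    using 1 2 unfolding next_meeting_def meeting_iff[OF e] by blast+
  have "\<not> ahead h z y" "\<not> ahead h y z" using 1 2 unfolding next_meeting_def by blast+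
  then have "\<not> Re z < Re y" "\<not> Re y < Re z" by (cases h; simp)+
  then have "inner_end e f = inner_end e g"
    using crossing_order_iff[OF e f(1) g(1) f(2) g(2) f(3,4) g(3,4)]
      crossing_order_iff[OF e g(1) f(1) g(2) f(2) g(3,4) f(3,4)] by simp
  then have "f = g" using inner_end_inj[OF e f(1) g(1) f(2) g(2)] by simp
  then show ?thesis using semicircles_meet_once[OF f(2)] f g by blast
qed

section \<open>Straight runs and turns of a walk\<close>

lemma finite_E: "finite E" 
proof (rule finite_subset)
  show "E \<subseteq> {..N} \<times> {..N}" by (auto simp: height_arcs_def)
qed simp

text \<open>A walk heading right turns only at an arc \<open>f\<close> with
  \<open>crosses f e\<close> and passes all others. The induction counts the arcs still to be met,
  the nearest having the least inner end.\<close>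

lemma straight_right:
  assumes e: "e \<in> E" and "\<And>f z. meeting w e f z \<Longrightarrow> Re p < Re z \<Longrightarrow> crosses e f"
  shows "walk w e Rightward p (snd e)"
  using assms(2)
proof (induction "card {f. \<exists>z. meeting w e f z \<and> Re p < Re z}" arbitrary: p rule: less_induct)
  case less
  let ?S = "\<lambda>p. {f. \<exists>z. meeting w e f z \<and> Re p < Re z}"
  have fin: "finite (?S p)" for p
    using two_matchings.finite_E[OF swapped] by (rule rev_finite_subset) (auto simp: meeting_iff[OF e])
  show ?case
  proof (cases "?S p = {}")
    case True
    then have "walk w e Rightward p (target e Rightward)" by (intro walk.stop) auto
    then show ?thesis by (cases e) auto
  next
    case False
    then obtain f where f: "f \<in> ?S p" "\<And>g. g \<in> ?S p \<Longrightarrow> inner_end e f \<le> inner_end e g"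
      using ex_has_least_nat[of "\<lambda>f. f \<in> ?S p" _ "inner_end e"] by blast
    then obtain z where z: "meeting w e f z" "Re p < Re z" by blast
    have cr: "crosses e f" using less.prems[OF z] .
    have nm: "next_meeting w e Rightward p f z" unfolding next_meeting_def
    proof (intro conjI allI impI)
      fix g y assume gy: "meeting w e g y \<and> ahead Rightward p y"
      then have "g \<in> ?S p" unfolding ahead.simps mem_Collect_eq by blast
      then have "inner_end e f \<le> inner_end e g" using f(2) by blast
      then show "\<not> ahead Rightward y z"
        using crossing_order_iff[OF e, of g f y z] gy z by (auto simp: meeting_iff[OF e])
    qed (use z in auto)
    have "?S z \<subset> ?S p"
    proof (rule psubsetI)
      show "?S z \<subseteq> ?S p" using z by fastforce
      have "f \<notin> ?S z"
      proof
        assume "f \<in> ?S z"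
        then obtain y where y: "meeting w e f y" "Re z < Re y" by blast
        then have "y = z" using semicircles_meet_once[of e f] z(1) by (auto simp: meeting_iff[OF e])
        then show False using y by simp
      qed
      then show "?S z \<noteq> ?S p" using f(1) by blast
    qed
    then have "card (?S z) < card (?S p)" using psubset_card_mono[OF fin] by blast
    then have "walk w e Rightward z (snd e)" using less.hyps[of z] less.prems z(2) by (meson less_trans)
    then show ?thesis using walk.step[OF nm, of e Rightward] cr by (simp add: turn_def)
  qed
qed

lemma inner_end_le: "f \<in> F \<Longrightarrow> inner_end e f \<le> N"
  by (auto simp: inner_end_def height_arcs_def)

lemma straight_left:
  assumes e: "e \<in> E" and "\<And>f z. meeting w e f z \<Longrightarrow> Re z < Re p \<Longrightarrow> \<not> crosses e f"
  shows "walk w e Leftward p (fst e)"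
  using assms(2)
proof (induction "card {f. \<exists>z. meeting w e f z \<and> Re z < Re p}" arbitrary: p rule: less_induct)
  case less
  let ?S = "\<lambda>p. {f. \<exists>z. meeting w e f z \<and> Re z < Re p}"
  have SF: "?S p \<subseteq> F" for p by (auto simp: meeting_iff[OF e])
  have fin: "finite (?S p)" for p
    using two_matchings.finite_E[OF swapped] SF by (rule rev_finite_subset)
  show ?case
  proof (cases "?S p = {}")
    case True
    then have "walk w e Leftward p (target e Leftward)" by (intro walk.stop) auto
    then show ?thesis by (cases e) auto
  next
    case False
    \<comment> \<open>Heading left, the nearest meeting has the largest inner end; subtraction from
      its bound \<open>N\<close> makes this a least value.\<close>
    then obtain f where f: "f \<in> ?S p" "\<And>g. g \<in> ?S p \<Longrightarrow> N - inner_end e f \<le> N - inner_end e g"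
      using ex_has_least_nat[of "\<lambda>f. f \<in> ?S p" _ "\<lambda>f. N - inner_end e f"] by blast
    then obtain z where z: "meeting w e f z" "Re z < Re p" by blast
    have cr: "\<not> crosses e f" using less.prems[OF z] .
    have nm: "next_meeting w e Leftward p f z" unfolding next_meeting_def
    proof (intro conjI allI impI)
      fix g y assume gy: "meeting w e g y \<and> ahead Leftward p y"
      then have g: "g \<in> ?S p" unfolding ahead.simps mem_Collect_eq by blast
      then have "inner_end e g \<le> N" "inner_end e f \<le> N" using SF f(1) inner_end_le by blast+
      then have "inner_end e g \<le> inner_end e f" using f(2)[OF g] by simp
      then show "\<not> ahead Leftward y z"
        using crossing_order_iff[OF e, of f g z y] gy z by (auto simp: meeting_iff[OF e])
    qed (use z in auto)
    have "?S z \<subset> ?S p"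
    proof (rule psubsetI)
      show "?S z \<subseteq> ?S p" using z by fastforce
      have "f \<notin> ?S z"
      proof
        assume "f \<in> ?S z"
        then obtain y where y: "meeting w e f y" "Re y < Re z" by blast
        then have "y = z" using semicircles_meet_once[of e f] z(1) by (auto simp: meeting_iff[OF e])
        then show False using y by simp
      qed
      then show "?S z \<noteq> ?S p" using f(1) by blast
    qed
    then have "card (?S z) < card (?S p)" using psubset_card_mono[OF fin] by blast
    then have "walk w e Leftward z (fst e)" using less.hyps[of z] less.prems z(2) by (meson less_trans)
    then show ?thesis using walk.step[OF nm, of e Leftward] cr by (simp add: turn_def)
  qed
qed

text \<open>The possible turns of a walk heading right come before the meetings that it passes
  straight, so the first turn is already the next meeting.\<close>

lemma turn_left:
  assumes e: "e \<in> E" and f: "f \<in> F" "crosses f e" and z: "z \<in> semicircle e" "z \<in> semicircle f" "Re p < Re z"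
    and min: "\<And>g y. g \<in> F \<Longrightarrow> crosses g e \<Longrightarrow> y \<in> semicircle e \<Longrightarrow> y \<in> semicircle g \<Longrightarrow> Re p < Re y \<Longrightarrow> snd f \<le> snd g"
    and "walk w f Leftward z j"
  shows "walk w e Rightward p j"
proof -
  have excl: "\<not> (crosses x y \<and> crosses y x)" for x y by (auto simp: crosses_def)
  have nm: "next_meeting w e Rightward p f z" unfolding next_meeting_def
  proof (intro conjI allI impI)
    fix g y assume "meeting w e g y \<and> ahead Rightward p y"
    then have g: "g \<in> F" "crosses e g \<or> crosses g e" "y \<in> semicircle e" "y \<in> semicircle g" "Re p < Re y"
      by (auto simp: meeting_iff[OF e])
    have "inner_end e f \<le> inner_end e g"
    proof (cases "crosses e g")
      case True then show ?thesis using right_not_before_left[OF e g(1) f(1) _ f(2)] f(2) excl by (auto simp: inner_end_def)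
    next
      case False then show ?thesis using min[OF g(1) _ g(3,4,5)] g(2) f(2) excl by (auto simp: inner_end_def)
    qed
    then show "\<not> ahead Rightward y z"
      using crossing_order_iff[OF e g(1) f(1) g(2) _ g(3,4) z(1,2)] f(2) by simp
  qed (use z f in \<open>auto simp: meeting_iff[OF e]\<close>)
  show ?thesis using walk.step[OF nm, of f Leftward] assms(8) f(2) excl by (auto simp: turn_def)
qed

lemma turn_right:
  assumes e: "e \<in> E" and f: "f \<in> F" "crosses e f" and z: "z \<in> semicircle e" "z \<in> semicircle f" "Re z < Re p"
    and max: "\<And>g y. g \<in> F \<Longrightarrow> crosses e g \<Longrightarrow> y \<in> semicircle e \<Longrightarrow> y \<in> semicircle g \<Longrightarrow> Re y < Re p \<Longrightarrow> fst g \<le> fst f"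
    and "walk w f Rightward z j"
  shows "walk w e Leftward p j"
proof -
  have excl: "\<not> (crosses x y \<and> crosses y x)" for x y by (auto simp: crosses_def)
  have nm: "next_meeting w e Leftward p f z" unfolding next_meeting_def
  proof (intro conjI allI impI)
    fix g y assume "meeting w e g y \<and> ahead Leftward p y"
    then have g: "g \<in> F" "crosses e g \<or> crosses g e" "y \<in> semicircle e" "y \<in> semicircle g" "Re y < Re p"
      by (auto simp: meeting_iff[OF e])
    have "inner_end e g \<le> inner_end e f"
    proof (cases "crosses e g")
      case True then show ?thesis using max[OF g(1) _ g(3,4,5)] f(2) by (auto simp: inner_end_def)
    next
      case False then show ?thesis using right_not_before_left[OF e f(1) g(1) f(2)] g(2) f(2) by (auto simp: inner_end_def)
    qed
    then show "\<not> ahead Leftward y z"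
      using crossing_order_iff[OF e f(1) g(1) _ g(2) z(1,2) g(3,4)] f(2) by simp
  qed (use z f in \<open>auto simp: meeting_iff[OF e]\<close>)
  show ?thesis using walk.step[OF nm, of f Rightward] assms(8) f(2) by (auto simp: turn_def)
qed

end

lemma (in two_matchings) walk_unique:
  assumes "walk w e h p j" "walk w e h p j'" "e \<in> arcs w"
  shows "j = j'"
  using assms
proof (induction arbitrary: j' rule: walk.induct)
  case (stop e h p)
  from stop.prems(1) show ?case
  proof cases
    case (step f z e' h') then show ?thesis using stop.hyps unfolding next_meeting_def by blast
  qed simp
next
  case (step e h p f z e' h' j)
  note hyps = step.hyps and IH = step.IH and e = step.prems(2)
  from step.prems(1) show ?case
  proof cases
    case stop then show ?thesis using hyps(1) unfolding next_meeting_def by blast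
  next
    case inner: (step f2 z2 e2 h2)
    have "f = f2 \<and> z = z2"
      using e next_meeting_unique[OF _ hyps(1) inner(1)]
        two_matchings.next_meeting_unique[OF swapped _ hyps(1) inner(1)]
      by (auto simp: arcs_eq)
    moreover have "f \<in> arcs w" using hyps(1) by (auto simp: next_meeting_def meeting_def)
    then have "e' \<in> arcs w" using hyps(2) e
      by (auto simp: turn_def split: if_splits heading.splits)
    ultimately show ?thesis using inner IH hyps(2) by auto
  qed
qed

section \<open>Trips\<close>

lemma crosses_asym: "crosses e f \<Longrightarrow> \<not> crosses f e"
  by (auto simp: crosses_def)

context excursion begin

lemma level_le:
  assumes "(p, q) \<in> height_arcs H N" "p \<le> i" "i \<le> q" "(p', q') \<in> height_arcs H N" "p' \<le> i" "i \<le> q'"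
    and "H q' \<le> H q"
  shows "p' \<le> p" "q \<le> q'"
proof -
  show "p' \<le> p"
  proof (rule ccontr)
    assume "\<not> p' \<le> p"
    then have "p \<le> p' - 1" "p' - 1 < q" using assms by auto
    then show False using arcD(5)[OF assms(1), of "p' - 1"] arcD(4)[OF assms(4)] assms by simp
  qed
  show "q \<le> q'"
  proof (rule ccontr)
    assume "\<not> q \<le> q'"
    then show False using arcD(5)[OF assms(1), of q'] assms by simp
  qed
qed

lemma level_less:
  assumes "(p, q) \<in> height_arcs H N" "p \<le> i" "i \<le> q" "(p', q') \<in> height_arcs H N" "p' \<le> i" "i \<le> q'"
    and "H q' < H q"
  shows "p' < p" "q < q'"
proof -
  have "p' \<noteq> p" "q' \<noteq> q"
    using assms(7) arcD(4)[OF assms(1)] arcD(4)[OF assms(4)] by auto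
  then show "p' < p" "q < q'" using level_le[OF assms(1-6)] assms(7) by auto
qed

lemma enclosing_level:
  assumes "(p, q) \<in> height_arcs H N" "(p', q') \<in> height_arcs H N" "p' < p" "q < q'"
  shows "H q' < H q"
proof -
  have "p' \<le> p - 1" "p - 1 < q'" using assms arcD(2)[OF assms(1)] by auto
  then show ?thesis using arcD(5)[OF assms(2), of "p - 1"] arcD(4)[OF assms(1)] by simp
qed

end

context two_matchings begin

text \<open>An arc that could turn the walk would lie in \<open>F\<close> and close under
  \<open>(i, b)\<close>, hence under \<open>(i, d)\<close>; it would cross that arc or start at
  \<open>i\<close>, which one matching excludes. For the criterion, \<open>b < d\<close> says that
  \<open>H\<close> loses the unit gained at \<open>i\<close> before \<open>K\<close> does.\<close>

lemma trip_from_up: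
  assumes b: "(i, b) \<in> E" and d: "(i, d) \<in> F" and bd: "b < d"
  shows "walk w (i, b) Rightward (of_nat i) b" "emits H K 0 N i" "\<not> emits K H 0 N i"
proof -
  have "crosses (i, b) f" if "meeting w (i, b) f z" "Re (of_nat i) < Re z" for f z
  proof (rule ccontr)
    assume "\<not> crosses (i, b) f"
    then have f: "f \<in> F" "crosses f (i, b)" using that meeting_iff[OF b] by auto
    obtain c c' where [simp]: "f = (c, c')" by (cases f)
    show False using f F.arc_noncrossing[of c c' i d] F.arc_fst_inj[of i c' d] d bd
      by (cases "c = i") (auto simp: crosses_def)
  qed
  then show "walk w (i, b) Rightward (of_nat i) b" using straight_right[OF b, of "of_nat i"] by simp
  have up: "H i = H (i - 1) + 1" "K i = K (i - 1) + 1" using E.arc_fst_up[OF b] F.arc_fst_up[OF d] .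
  have "K i - 1 < K t" if "i \<le> t" "t \<le> b" for t
    using F.arcD(5)[OF d, of t] F.arcD(4)[OF d] that bd up by simp
  then have "drops H K N i 1" unfolding drops_def
    using E.arcD(2-4)[OF b] up by (intro exI[of _ b]) auto
  then show "emits H K 0 N i" unfolding emits_def using up by simp
  have "\<not> drops K H N i 1"
  proof
    assume "drops K H N i 1"
    then obtain q where q: "i < q" "K q = K i - 1" "\<And>t. i \<le> t \<Longrightarrow> t \<le> q \<Longrightarrow> H i - 1 < H t"
      unfolding drops_def by blast
    have "\<not> q < d" using F.arcD(5)[OF d, of q] F.arcD(4)[OF d] q up by auto
    then show False using q(3)[of b] E.arcD(2,4)[OF b] up bd by auto
  qed
  then show "\<not> emits K H 0 N i" unfolding emits_def using up by simp
qed

end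

section \<open>The trip from a letter other than A\<close>

locale trip_from_down = two_matchings +
  fixes i :: nat
  assumes i: "1 \<le> i" "i \<le> N" and down: "H i = H (i - 1) - 1"
begin

lemma flat: "K i = K (i - 1)"
  by (rule height_path_step[OF pathHK, of i]) (use i down in auto)

text \<open>Arcs over \<open>i\<close> are indexed by how far their level lies below the height at
  \<open>i\<close>. The weak bound \<open>i \<le> snd e\<close> admits the arc ending at
  \<open>i\<close>, which has index 0.\<close>

definition own_arc :: "nat \<Rightarrow> arc" where
  "own_arc k = (SOME e. e \<in> E \<and> fst e \<le> i \<and> i \<le> snd e \<and> H (snd e) = H i - int k)"

definition other_arc :: "nat \<Rightarrow> arc" where
  "other_arc k = (SOME f. f \<in> F \<and> fst f \<le> i \<and> i \<le> snd f \<and> K (snd f) = K i - int k)"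

lemma own_arc:
  assumes "int k \<le> H i"
  shows "own_arc k \<in> E" "fst (own_arc k) \<le> i" "i \<le> snd (own_arc k)" "H (snd (own_arc k)) = H i - int k"
    "H (fst (own_arc k) - 1) = H i - int k" "\<And>t. fst (own_arc k) \<le> t \<Longrightarrow> t < snd (own_arc k) \<Longrightarrow> H i - int k < H t"
proof -
  have "\<exists>e. e \<in> E \<and> fst e \<le> i \<and> i \<le> snd e \<and> H (snd e) = H i - int k"
  proof (cases "k = 0")
    case True
    obtain p where p: "(p, i) \<in> E" using E.arc_to_down[of i] i down by blast
    then show ?thesis using E.arcD(2)[OF p] True by (intro exI[of _ "(p, i)"]) auto
  next
    case False
    obtain p q where "(p, q) \<in> E" "p \<le> i" "i < q" "H q = H i - int k"
      using E.level_arc_ex[of i "int k"] i assms False by auto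
    then show ?thesis by (intro exI[of _ "(p, q)"]) auto
  qed
  from someI_ex[OF this] show *: "own_arc k \<in> E" "fst (own_arc k) \<le> i" "i \<le> snd (own_arc k)" "H (snd (own_arc k)) = H i - int k"
    unfolding own_arc_def by auto
  have "(fst (own_arc k), snd (own_arc k)) \<in> E" using * by simp
  note d = E.arcD[OF this]
  show "H (fst (own_arc k) - 1) = H i - int k" using d(4) *(4) by simp
  show "H i - int k < H t" if "fst (own_arc k) \<le> t" "t < snd (own_arc k)" for t using d(5)[OF that] *(4) by simp
qed

lemma other_arc:
  assumes "1 \<le> k" "int k \<le> K i"
  shows "other_arc k \<in> F" "fst (other_arc k) < i" "i < snd (other_arc k)" "K (snd (other_arc k)) = K i - int k"
    "K (fst (other_arc k) - 1) = K i - int k" "\<And>t. fst (other_arc k) \<le> t \<Longrightarrow> t < snd (other_arc k) \<Longrightarrow> K i - int k < K t"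
proof -
  obtain p q where "(p, q) \<in> F" "p \<le> i" "i < q" "K q = K i - int k"
    using F.level_arc_ex[of i "int k"] i assms by auto
  then have "\<exists>f. f \<in> F \<and> fst f \<le> i \<and> i \<le> snd f \<and> K (snd f) = K i - int k"
    by (intro exI[of _ "(p, q)"]) auto
  from someI_ex[OF this] have *: "other_arc k \<in> F" "fst (other_arc k) \<le> i" "i \<le> snd (other_arc k)" "K (snd (other_arc k)) = K i - int k"
    unfolding other_arc_def by auto
  have F': "(fst (other_arc k), snd (other_arc k)) \<in> F" using * by simp
  note d = F.arcD[OF F']
  show "other_arc k \<in> F" "K (snd (other_arc k)) = K i - int k" using * by auto
  have "fst (other_arc k) \<noteq> i" using F.arc_fst_up[OF F'] flat by auto
  then show "fst (other_arc k) < i" using * by simp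
  have "snd (other_arc k) \<noteq> i" using *(4) assms by auto
  then show "i < snd (other_arc k)" using * by simp
  show "K (fst (other_arc k) - 1) = K i - int k" using d(4) *(4) by simp
  show "K i - int k < K t" if "fst (other_arc k) \<le> t" "t < snd (other_arc k)" for t using d(5)[OF that] *(4) by simp
qed

lemma snd_own_arc_0: "snd (own_arc 0) = i"
proof -
  have 0: "int 0 \<le> H i" using E.ge0 by simp
  show ?thesis using own_arc(2,3,4)[OF 0] own_arc(6)[OF 0, of i] by (cases "snd (own_arc 0) = i") auto
qed

text \<open>The trip from \<open>i\<close> runs leftward along \<open>own_arc k\<close> until it meets \<open>other_arc (k + 1)\<close>, then rightward along that
  arc until it meets \<open>own_arc (k + 1)\<close>, and so on outwards; \<open>left_ok k\<close> and \<open>right_ok k\<close> say that these two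
  meetings take place.\<close>

definition left_ok :: "nat \<Rightarrow> bool" where
  "left_ok k \<longleftrightarrow> int (Suc k) \<le> K i \<and> fst (own_arc k) \<le> fst (other_arc (Suc k))"

definition right_ok :: "nat \<Rightarrow> bool" where
  "right_ok k \<longleftrightarrow> int (Suc k) \<le> H i \<and> snd (own_arc (Suc k)) < snd (other_arc (Suc k))"

text \<open>The walk is about to head left along \<open>own_arc k\<close> from \<open>p\<close>:
  initially \<open>p\<close> is \<open>i\<close>, later it is the crossing with
  \<open>other_arc k\<close> at which the walk turned.\<close>

definition left_state :: "nat \<Rightarrow> complex \<Rightarrow> bool" where
  "left_state k p \<longleftrightarrow> int k \<le> H i \<and> (if k = 0 then p = of_nat i else
     int k \<le> K i \<and> crosses (own_arc k) (other_arc k) \<and> p \<in> semicircle (own_arc k) \<and> p \<in> semicircle (other_arc k))"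

text \<open>Every possible turn on the way left is onto an arc around \<open>i\<close> of index at
  least \<open>k + 1\<close>: for \<open>k > 0\<close> it opens to the left of
  \<open>other_arc k\<close> and so encloses it. The innermost of these has the rightmost left end,
  hence \<open>other_arc (k + 1)\<close> alone decides whether the walk turns.\<close>

lemma left_candidates:
  assumes s: "left_state k p" and g: "g \<in> F" "crosses (own_arc k) g" "y \<in> semicircle (own_arc k)" "y \<in> semicircle g" "Re y < Re p"
  shows "fst g \<le> i" "i < snd g" "K (snd g) \<le> K i - int (Suc k)"
proof -
  have k: "int k \<le> H i" using s by (simp add: left_state_def)
  obtain c d where [simp]: "g = (c, d)" by (cases g)
  have G: "(c, d) \<in> F" using g by simp
  have "fst g \<le> i \<and> i < snd g \<and> K (snd g) \<le> K i - int (Suc k)"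
  proof (cases "k = 0")
    case True
    then have "c < i" "i < d" using g(2) snd_own_arc_0 by (auto simp: crosses_def)
    then show ?thesis using F.arcD(5)[OF G, of i] True by simp
  next
    case False
    then have st: "int k \<le> K i" "crosses (own_arc k) (other_arc k)" "p \<in> semicircle (own_arc k)" "p \<in> semicircle (other_arc k)"
      using s by (auto simp: left_state_def)
    note f = other_arc[of k, OF _ st(1)]
    have f1: "other_arc k \<in> F" "fst (other_arc k) < i" "i < snd (other_arc k)" "K (snd (other_arc k)) = K i - int k" using f False by auto
    have "inner_end (own_arc k) g < inner_end (own_arc k) (other_arc k)"
      using crossing_order_iff[OF own_arc(1)[OF k] g(1) f1(1) _ _ g(3,4) st(3,4)] g(2,5) st(2) by simp
    then have c: "c < fst (other_arc k)" using g(2) st(2) by (simp add: inner_end_def)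
    moreover have "fst (other_arc k) < d" using g(2) st(2) by (auto simp: crosses_def)
    ultimately have "snd (other_arc k) < d" using F.arc_noncrossing[OF G, of "fst (other_arc k)" "snd (other_arc k)"] f1 by simp
    moreover have "K d < K (snd (other_arc k))"
      using F.enclosing_level[OF _ G c] calculation f1 by (metis prod.collapse)
    ultimately show ?thesis using c f1 by simp
  qed
  then show "fst g \<le> i" "i < snd g" "K (snd g) \<le> K i - int (Suc k)" by auto
qed

lemma candidate_level:
  assumes "g \<in> F" "fst g \<le> i" "i < snd g" "K (snd g) \<le> K i - int (Suc k)"
  shows "int (Suc k) \<le> K i" "fst g \<le> fst (other_arc (Suc k))"
proof -
  show k: "int (Suc k) \<le> K i" using assms(4) F.ge0[of "snd g"] by simp
  note f = other_arc[of "Suc k", OF _ k]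
  show "fst g \<le> fst (other_arc (Suc k))"
    using F.level_le(1)[of "fst (other_arc (Suc k))" "snd (other_arc (Suc k))" i "fst g" "snd g"] f(1-4) assms by simp
qed

lemma left_stop:
  assumes s: "left_state k p" and "\<not> left_ok k"
  shows "walk w (own_arc k) Leftward p (fst (own_arc k))"
proof -
  have k: "int k \<le> H i" using s by (simp add: left_state_def)
  show ?thesis
  proof (rule straight_left[OF own_arc(1)[OF k]])
    fix f z assume m: "meeting w (own_arc k) f z" "Re z < Re p"
    show "\<not> crosses (own_arc k) f"
    proof
      assume c: "crosses (own_arc k) f"
      then have f: "f \<in> F" "z \<in> semicircle (own_arc k)" "z \<in> semicircle f"
        using m meeting_iff[OF own_arc(1)[OF k]] by auto
      note l = left_candidates[OF s f(1) c f(2,3) m(2)]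
      show False using candidate_level[OF f(1) l] c assms(2) by (auto simp: left_ok_def crosses_def)
    qed
  qed
qed

lemma left_turn:
  assumes s: "left_state k p" and ok: "left_ok k"
  obtains z where "crosses (own_arc k) (other_arc (Suc k))" "z \<in> semicircle (own_arc k)" "z \<in> semicircle (other_arc (Suc k))"
    "\<And>j. walk w (other_arc (Suc k)) Rightward z j \<Longrightarrow> walk w (own_arc k) Leftward p j"
proof -
  have k: "int k \<le> H i" using s by (simp add: left_state_def)
  have k': "int (Suc k) \<le> K i" using ok by (simp add: left_ok_def)
  note e = own_arc[OF k] and f = other_arc[of "Suc k", OF _ k']
  have lev: "fst (other_arc (Suc k)) < fst (other_arc k) \<and> snd (other_arc k) < snd (other_arc (Suc k))" if "k \<noteq> 0"
  proof -
    have "1 \<le> k" "int k \<le> K i" using that k' by auto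
    note g = other_arc[OF this]
    show ?thesis
      using F.level_less[of "fst (other_arc k)" "snd (other_arc k)" i "fst (other_arc (Suc k))" "snd (other_arc (Suc k))"] f(1-4) g(1-4) by simp
  qed
  \<comment> \<open>\<open>left_ok\<close> controls left ends only. The right ends compare well
    because \<open>own_arc 0\<close> ends at \<open>i\<close>, and for \<open>k > 0\<close> because
    \<open>own_arc k\<close> crosses \<open>other_arc k\<close>, which lies inside the next
    one.\<close>
  have "snd (own_arc k) < snd (other_arc (Suc k))"
  proof (cases "k = 0")
    case True then show ?thesis using f(3) snd_own_arc_0 by simp
  next
    case False then show ?thesis using lev s by (auto simp: left_state_def crosses_def)
  qed
  then have c: "crosses (own_arc k) (other_arc (Suc k))" using ok e(3) f(2) by (auto simp: left_ok_def crosses_def)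
  then obtain z where z: "z \<in> semicircle (own_arc k)" "z \<in> semicircle (other_arc (Suc k))"
    using semicircles_meet_once[of "own_arc k" "other_arc (Suc k)"] by blast
  have zp: "Re z < Re p"
  proof (cases "k = 0")
    case True
    have "Re z < real (snd (own_arc k))"
      using crossing_bounds(2)[of "fst (own_arc k)" "snd (own_arc k)" "fst (other_arc (Suc k))" "snd (other_arc (Suc k))" z] c z
      by (simp only: prod.collapse)
    then show ?thesis using True snd_own_arc_0 s by (simp add: left_state_def)
  next
    case False
    then have st: "int k \<le> K i" "crosses (own_arc k) (other_arc k)" "p \<in> semicircle (own_arc k)" "p \<in> semicircle (other_arc k)"
      using s by (auto simp: left_state_def)
    have "other_arc k \<in> F" using other_arc(1)[of k] st False by auto
    then show ?thesis
      using crossing_order_iff[OF e(1) f(1), of "other_arc k" z p] c z st lev False by (simp add: inner_end_def)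
  qed
  have "walk w (own_arc k) Leftward p j" if "walk w (other_arc (Suc k)) Rightward z j" for j
  proof (rule turn_right[OF e(1) f(1) c z zp])
    fix g y assume g: "g \<in> F" "crosses (own_arc k) g" "y \<in> semicircle (own_arc k)" "y \<in> semicircle g" "Re y < Re p"
    show "fst g \<le> fst (other_arc (Suc k))" using candidate_level(2)[OF g(1) left_candidates[OF s g]] .
  qed (use that in auto)
  then show thesis using that c z by blast
qed

text \<open>Counterpart of \<open>left_candidates\<close> on the way right: an arc at which the walk
  could turn closes after \<open>own_arc k\<close> and so encloses it, which makes its index at
  least \<open>k + 1\<close>.\<close>

lemma right_candidates:
  assumes k: "int k \<le> H i" "int (Suc k) \<le> K i" and c: "crosses (own_arc k) (other_arc (Suc k))"
    and z: "z \<in> semicircle (own_arc k)" "z \<in> semicircle (other_arc (Suc k))"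
    and g: "g \<in> E" "crosses g (other_arc (Suc k))" "y \<in> semicircle (other_arc (Suc k))" "y \<in> semicircle g" "Re z < Re y"
  shows "int (Suc k) \<le> H i" "snd (own_arc (Suc k)) \<le> snd g"
proof -
  interpret S: two_matchings K H N w by (rule swapped)
  note e = own_arc[OF k(1)] and f = other_arc[of "Suc k", OF _ k(2)]
  obtain p q where [simp]: "g = (p, q)" by (cases g)
  have G: "(p, q) \<in> E" and E': "(fst (own_arc k), snd (own_arc k)) \<in> E" using g e by auto
  have "inner_end (other_arc (Suc k)) (own_arc k) < inner_end (other_arc (Suc k)) g"
    using S.crossing_order_iff[OF f(1) e(1) g(1) _ _ z(2,1) g(3,4)] c g(2,5) by simp
  then have q: "snd (own_arc k) < q" using crosses_asym[OF c] crosses_asym[OF g(2)] by (simp add: inner_end_def)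
  have "p < snd (own_arc k)" using g(2) c by (auto simp: crosses_def)
  then have p: "p < fst (own_arc k)"
    using E.arc_noncrossing[OF E' G] E.arc_fst_inj[OF E', of q] G q
    by (cases p "fst (own_arc k)" rule: linorder_cases) auto
  have Hq: "H q < H i - int k" using E.enclosing_level[OF E' G p q] e(4) by simp
  then show k1: "int (Suc k) \<le> H i" using E.ge0[of q] by simp
  note e1 = own_arc[OF k1]
  show "snd (own_arc (Suc k)) \<le> snd g"
    using E.level_le(2)[of "fst (own_arc (Suc k))" "snd (own_arc (Suc k))" i p q] e1(1-4) G Hq p q e(2,3) by simp
qed

lemma right_stop:
  assumes k: "int k \<le> H i" "int (Suc k) \<le> K i" and c: "crosses (own_arc k) (other_arc (Suc k))"
    and z: "z \<in> semicircle (own_arc k)" "z \<in> semicircle (other_arc (Suc k))" and "\<not> right_ok k"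
  shows "walk w (other_arc (Suc k)) Rightward z (snd (other_arc (Suc k)))"
proof -
  interpret S: two_matchings K H N w by (rule swapped)
  note f = other_arc[of "Suc k", OF _ k(2)]
  have f1: "other_arc (Suc k) \<in> F" using f(1) by simp
  show ?thesis
  proof (rule S.straight_right[OF f1])
    fix g y assume m: "meeting w (other_arc (Suc k)) g y" "Re z < Re y"
    then have g: "g \<in> E" "crosses (other_arc (Suc k)) g \<or> crosses g (other_arc (Suc k))"
      "y \<in> semicircle (other_arc (Suc k))" "y \<in> semicircle g"
      using S.meeting_iff[OF f1] by auto
    show "crosses (other_arc (Suc k)) g"
    proof (rule ccontr)
      assume "\<not> crosses (other_arc (Suc k)) g"
      then have cg: "crosses g (other_arc (Suc k))" using g(2) by simp
      show False
        using right_candidates[OF k c z g(1) cg g(3,4) m(2)] cg assms(6) by (auto simp: right_ok_def crosses_def)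
    qed
  qed
qed

lemma right_turn:
  assumes k: "int k \<le> H i" "int (Suc k) \<le> K i" and c: "crosses (own_arc k) (other_arc (Suc k))"
    and z: "z \<in> semicircle (own_arc k)" "z \<in> semicircle (other_arc (Suc k))" and ok: "right_ok k"
  obtains p where "left_state (Suc k) p"
    "\<And>j. walk w (own_arc (Suc k)) Leftward p j \<Longrightarrow> walk w (other_arc (Suc k)) Rightward z j"
proof -
  interpret S: two_matchings K H N w by (rule swapped)
  have k1: "int (Suc k) \<le> H i" using ok by (simp add: right_ok_def)
  note e = own_arc[OF k(1)] and e1 = own_arc[OF k1]
  have f: "other_arc (Suc k) \<in> F" "fst (other_arc (Suc k)) < i" using other_arc[of "Suc k", OF _ k(2)] by auto
  have lev: "fst (own_arc (Suc k)) < fst (own_arc k)" "snd (own_arc k) < snd (own_arc (Suc k))"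
    using E.level_less[of "fst (own_arc k)" "snd (own_arc k)" i "fst (own_arc (Suc k))" "snd (own_arc (Suc k))"] e(1-4) e1(1-4) by auto
  have c1: "crosses (own_arc (Suc k)) (other_arc (Suc k))"
    using lev c ok f(2) e1(3) by (auto simp: crosses_def right_ok_def)
  then obtain p where p: "p \<in> semicircle (own_arc (Suc k))" "p \<in> semicircle (other_arc (Suc k))"
    using semicircles_meet_once[of "own_arc (Suc k)" "other_arc (Suc k)"] by blast
  have lt: "Re z < Re p"
    using S.crossing_order_iff[OF f(1) e(1) e1(1) _ _ z(2,1) p(2,1)] c c1 lev crosses_asym[OF c] crosses_asym[OF c1]
    by (simp add: inner_end_def)
  have "walk w (other_arc (Suc k)) Rightward z j" if "walk w (own_arc (Suc k)) Leftward p j" for j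
  proof (rule S.turn_left[OF f(1) e1(1) c1 p(2,1) lt])
    fix g y assume g: "g \<in> E" "crosses g (other_arc (Suc k))" "y \<in> semicircle (other_arc (Suc k))" "y \<in> semicircle g" "Re z < Re y"
    show "snd (own_arc (Suc k)) \<le> snd g" using right_candidates(2)[OF k c z g] .
  qed (use that in auto)
  moreover have "left_state (Suc k) p" using k1 k(2) c1 p by (simp add: left_state_def)
  ultimately show thesis using that by blast
qed

lemma walk_from_left_state:
  assumes "left_state k p"
  shows "\<exists>m\<ge>k. int m \<le> H i \<and> (\<forall>l. k \<le> l \<and> l < m \<longrightarrow> left_ok l \<and> right_ok l) \<and>
    (\<not> left_ok m \<and> walk w (own_arc k) Leftward p (fst (own_arc m)) \<or>
     left_ok m \<and> \<not> right_ok m \<and> walk w (own_arc k) Leftward p (snd (other_arc (Suc m))))"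
  using assms
\<comment> \<open>Each return to an own arc uses up one of the \<open>H i\<close> levels below the
  height at \<open>i\<close>.\<close>
proof (induction "nat (H i) - k" arbitrary: k p rule: less_induct)
  case less
  have k: "int k \<le> H i" using less.prems by (simp add: left_state_def)
  show ?case
  proof (cases "left_ok k")
    case False
    then show ?thesis using left_stop[OF less.prems] k by (intro exI[of _ k]) auto
  next
    case True
    have k': "int (Suc k) \<le> K i" using True by (simp add: left_ok_def)
    obtain z where z: "crosses (own_arc k) (other_arc (Suc k))" "z \<in> semicircle (own_arc k)" "z \<in> semicircle (other_arc (Suc k))"
      "\<And>j. walk w (other_arc (Suc k)) Rightward z j \<Longrightarrow> walk w (own_arc k) Leftward p j"
      using left_turn[OF less.prems True] by blast
    show ?thesis
    proof (cases "right_ok k")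
      case False
      then show ?thesis using right_stop[OF k k' z(1-3)] z(4) k True by (intro exI[of _ k]) auto
    next
      case ok: True
      obtain p' where p': "left_state (Suc k) p'"
        "\<And>j. walk w (own_arc (Suc k)) Leftward p' j \<Longrightarrow> walk w (other_arc (Suc k)) Rightward z j"
        using right_turn[OF k k' z(1-3) ok] by blast
      have "nat (H i) - Suc k < nat (H i) - k" using ok by (auto simp: right_ok_def)
      from less.hyps[OF this p'(1)] obtain m where m: "Suc k \<le> m" "int m \<le> H i"
        "\<forall>l. Suc k \<le> l \<and> l < m \<longrightarrow> left_ok l \<and> right_ok l"
        "\<not> left_ok m \<and> walk w (own_arc (Suc k)) Leftward p' (fst (own_arc m)) \<or>
         left_ok m \<and> \<not> right_ok m \<and> walk w (own_arc (Suc k)) Leftward p' (snd (other_arc (Suc m)))" by blast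
      have "left_ok l \<and> right_ok l" if "k \<le> l" "l < m" for l
        using m(3) that True ok by (cases "l = k") auto
      then show ?thesis using m p'(2) z(4) by (intro exI[of _ m]) auto
    qed
  qed
qed

text \<open>The witness is \<open>m + 1\<close>: \<open>other_arc (m + 1)\<close> closes while
  \<open>own_arc (m + 1)\<close> is still open or does not exist, which gives \<open>drops\<close>;
  the left turns at all indices up to \<open>m\<close> give \<open>rises\<close>.\<close>

lemma emits_if_right_fails:
  assumes m: "int m \<le> H i" and ok: "\<And>l. l < m \<Longrightarrow> left_ok l \<and> right_ok l" and "left_ok m" "\<not> right_ok m"
  shows "emits K H 0 N i"
proof -
  have k: "int (Suc m) \<le> K i" using assms(3) by (simp add: left_ok_def)
  note f = other_arc[of "Suc m", OF _ k]
  let ?q = "snd (other_arc (Suc m))"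
  have "H i - int (Suc m) < H t" if t: "i \<le> t" "t \<le> ?q" for t
  proof (rule ccontr)
    assume n: "\<not> H i - int (Suc m) < H t"
    then have m1: "int (Suc m) \<le> H i" using E.ge0[of t] by simp
    note e = own_arc[OF m1]
    have "snd (own_arc (Suc m)) \<le> t" using e(6)[of t] e(2) t n by (cases "t < snd (own_arc (Suc m))") auto
    moreover have "snd (own_arc (Suc m)) \<noteq> ?q"
      using ends_distinct(2)[of "fst (own_arc (Suc m))" "snd (own_arc (Suc m))" "fst (other_arc (Suc m))" ?q] e(1) f(1) by auto
    ultimately show False using assms(4) m1 t by (auto simp: right_ok_def)
  qed
  moreover have "?q \<le> N" using F.arcD(3)[of "fst (other_arc (Suc m))" ?q] f(1) by auto
  ultimately have dr: "drops K H N i (int (Suc m))" unfolding drops_def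
    using f(3,4) by (intro exI[of _ ?q]) auto
  have "rises K H 0 i (int (Suc m))" unfolding rises_def
  proof (intro allI impI)
    fix t assume t: "0 \<le> t \<and> t < i"
    define r where "r = min (int (Suc m)) (H (i - 1) - H t)"
    show "\<exists>s\<ge>t. s < i \<and> min (int (Suc m)) (H (i - 1) - H t) \<le> K i - K s"
    proof (cases "r \<le> 0")
      case True
      then show ?thesis unfolding r_def[symmetric] using t flat by (intro exI[of _ "i - 1"]) auto
    next
      case False
      \<comment> \<open>The height at \<open>i - 1\<close> is one above that at \<open>i\<close>, so
        \<open>t\<close> comes before \<open>own_arc l\<close> opens; the witness is the time just
        before \<open>other_arc (l + 1)\<close> opens.\<close>
      define l where "l = nat r - 1"
      have l: "r = int (Suc l)" using False by (simp add: l_def)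
      then have lm: "l \<le> m" by (simp add: r_def)
      have "int (Suc l) \<le> H (i - 1) - H t" using l by (simp add: r_def)
      then have Ht: "H t \<le> H i - int l" using down by simp
      then have lH: "int l \<le> H i" using E.ge0[of t] by simp
      note e = own_arc[OF lH]
      have "t < fst (own_arc l)" using e(6)[of t] e(3) t Ht by (cases "t < fst (own_arc l)") auto
      moreover have "left_ok l" using ok[of l] assms(3) lm by (cases "l = m") auto
      ultimately have "int (Suc l) \<le> K i" "t < fst (other_arc (Suc l))" by (auto simp: left_ok_def)
      then show ?thesis unfolding r_def[symmetric] using other_arc[of "Suc l"] l
        by (intro exI[of _ "fst (other_arc (Suc l)) - 1"]) auto
    qed
  qed
  then show ?thesis unfolding emits_def using dr down by (intro disjI2 conjI exI[of _ "int (Suc m)"]) auto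
qed

text \<open>Any \<open>c\<close> fails. If \<open>c \<le> m\<close>, the right turn at
  \<open>c - 1\<close> means that \<open>own_arc c\<close> closes before \<open>other_arc c\<close>,
  against \<open>drops\<close>. If \<open>c > m\<close>, \<open>rises\<close> just before
  \<open>own_arc m\<close> opens would make \<open>other_arc (m + 1)\<close> open late enough for
  one more left turn.\<close>

lemma not_emits_if_left_fails:
  assumes m: "int m \<le> H i" and ok: "\<And>l. l < m \<Longrightarrow> left_ok l \<and> right_ok l" and "\<not> left_ok m"
  shows "\<not> emits K H 0 N i"
proof
  assume "emits K H 0 N i"
  then obtain c where c: "1 \<le> c" "drops K H N i c" "rises K H 0 i c"
    unfolding emits_def using flat by auto
  obtain q where q: "i < q" "q \<le> N" "K q = K i - c" "\<And>t. i \<le> t \<Longrightarrow> t \<le> q \<Longrightarrow> H i - c < H t"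
    using c(2) unfolding drops_def by blast
  show False
  proof (cases "c \<le> int m")
    case True
    define l where "l = nat c - 1"
    have l: "c = int (Suc l)" "l < m" using c(1) True by (auto simp: l_def)
    have l1: "int (Suc l) \<le> H i" "int (Suc l) \<le> K i" and r: "snd (own_arc (Suc l)) < snd (other_arc (Suc l))"
      using ok[OF l(2)] by (auto simp: left_ok_def right_ok_def)
    note f = other_arc[of "Suc l", OF _ l1(2)] and e = own_arc[OF l1(1)]
    have "\<not> q < snd (other_arc (Suc l))" using f(6)[of q] f(2) q l by auto
    then show False using q(4)[of "snd (own_arc (Suc l))"] e(3,4) r l by simp
  next
    case False
    note e = own_arc[OF m]
    let ?t = "fst (own_arc m) - 1"
    have e1: "1 \<le> fst (own_arc m)" using E.arcD(1)[of "fst (own_arc m)" "snd (own_arc m)"] e(1) by simp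
    then have "?t < i" using e(2) by simp
    then obtain s where s: "?t \<le> s" "s < i" "min c (H (i - 1) - H ?t) \<le> K i - K s"
      using c(3) unfolding rises_def by blast
    have Ks: "int (Suc m) \<le> K i - K s" using s(3) e(5) False down by simp
    then have m1: "int (Suc m) \<le> K i" using F.ge0[of s] by simp
    note f = other_arc[of "Suc m", OF _ m1]
    have "s < fst (other_arc (Suc m))" using f(6)[of s] f(3) s(2) Ks by (cases "s < fst (other_arc (Suc m))") auto
    then show False using assms(3) m1 s(1) e1 by (simp add: left_ok_def)
  qed
qed

lemma trip:
  obtains e j where "e \<in> E" "snd e = i" "walk w e Leftward (of_nat i) j"
    "emits K H 0 N i \<and> (\<exists>p. (p, j) \<in> F) \<or> \<not> emits K H 0 N i \<and> (\<exists>q. (j, q) \<in> E)"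
proof -
  have 0: "int 0 \<le> H i" using E.ge0 by simp
  have "left_state 0 (of_nat i)" using E.ge0 by (simp add: left_state_def)
  from walk_from_left_state[OF this] obtain m where m: "int m \<le> H i"
    "\<And>l. l < m \<Longrightarrow> left_ok l \<and> right_ok l"
    "\<not> left_ok m \<and> walk w (own_arc 0) Leftward (of_nat i) (fst (own_arc m)) \<or>
     left_ok m \<and> \<not> right_ok m \<and> walk w (own_arc 0) Leftward (of_nat i) (snd (other_arc (Suc m)))" by auto
  have E0: "own_arc 0 \<in> E" using own_arc(1)[OF 0] .
  from m(3) show thesis
  proof
    assume a: "\<not> left_ok m \<and> walk w (own_arc 0) Leftward (of_nat i) (fst (own_arc m))"
    have "(fst (own_arc m), snd (own_arc m)) \<in> E" using own_arc(1)[OF m(1)] by simp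
    then show thesis using that[OF E0 snd_own_arc_0] a not_emits_if_left_fails[OF m(1,2)] by blast
  next
    assume a: "left_ok m \<and> \<not> right_ok m \<and> walk w (own_arc 0) Leftward (of_nat i) (snd (other_arc (Suc m)))"
    then have "int (Suc m) \<le> K i" by (simp add: left_ok_def)
    then have "(fst (other_arc (Suc m)), snd (other_arc (Suc m))) \<in> F" using other_arc(1)[of "Suc m"] by simp
    then show thesis using that[OF E0 snd_own_arc_0] a emits_if_right_fails[OF m(1,2)] by blast
  qed
qed

lemma not_emits_own: "\<not> emits H K 0 N i"
  unfolding emits_def using down flat by auto

end

section \<open>Trip permutation and evacuation\<close>

lemma kreweras_two_matchings:
  assumes "kreweras n w"
  shows "two_matchings (height B w) (height C w) (length w) w"
  using kreweras_excursion[OF assms] kmatching_height_arcs[OF assms] height_path_word[of w] assms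
  by (simp add: two_matchings_def arcs_def kreweras_dominant)

context two_matchings begin

lemma start_unique:
  assumes "start w i e h" "start w i e' h'"
  shows "e = e' \<and> h = h'"
proof -
  interpret S: two_matchings K H N w by (rule swapped)
  obtain a b c d where [simp]: "e = (a, b)" "e' = (c, d)" by (cases e, cases e')
  have "(a, b) \<in> arcs w" "(c, d) \<in> arcs w" using assms by (auto simp: start_def)
  then have "a = c" if "b = d"
    using that E.arc_snd_inj[of a b c] F.arc_snd_inj[of a b c] ends_distinct(2)[of a b c d] S.ends_distinct(2)[of a b c d]
    by (auto simp: arcs_eq)
  then show ?thesis using assms by (fastforce simp: start_def split: if_splits)
qed

lemma trip_perm_eq:
  assumes "start w i e h" "walk w e h (of_nat i) j"
  shows "trip_perm w i = j"
  unfolding trip_perm_def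
proof (rule the_equality)
  show "\<exists>e h. start w i e h \<and> walk w e h (of_nat i) j" using assms by blast
  fix j' assume "\<exists>e h. start w i e h \<and> walk w e h (of_nat i) j'"
  then obtain e' h' where "start w i e' h'" "walk w e' h' (of_nat i) j'" by blast
  then show "j' = j" using start_unique[OF assms(1)] walk_unique[OF _ assms(2)] assms(1)
    by (auto simp: start_def)
qed

lemma trip_perm_from_up:
  assumes b: "(i, b) \<in> E" and d: "(i, d) \<in> F" and "b < d" "letter_at w i = A"
  shows "trip_perm w i = b"
proof -
  have "b \<le> snd f" if f: "f \<in> arcs w" "fst f = i" for f
  proof -
    obtain q where q: "f = (i, q)" using f(2) by (cases f) auto
    then have "(i, q) \<in> E \<or> (i, q) \<in> F" using f(1) by (simp add: arcs_eq)
    then have "q = b \<or> q = d" using E.arc_fst_inj[OF _ b] F.arc_fst_inj[OF _ d] by blast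
    then show ?thesis using q \<open>b < d\<close> by auto
  qed
  then have "start w i (i, b) Rightward" using assms(4) b by (simp add: start_def arcs_eq)
  then show ?thesis using trip_perm_eq trip_from_up(1)[OF b d \<open>b < d\<close>] by blast
qed

end

lemma (in trip_from_down) trip_perm_from_down:
  assumes "letter_at w i \<noteq> A"
  shows "emits K H 0 N i \<and> (\<exists>p. (p, trip_perm w i) \<in> F) \<or> \<not> emits K H 0 N i \<and> (\<exists>q. (trip_perm w i, q) \<in> E)"
proof -
  obtain e j where e: "e \<in> E" "snd e = i" "walk w e Leftward (of_nat i) j"
    "emits K H 0 N i \<and> (\<exists>p. (p, j) \<in> F) \<or> \<not> emits K H 0 N i \<and> (\<exists>q. (j, q) \<in> E)"
    using trip by blast
  have "start w i e Leftward" using e assms by (simp add: start_def arcs_eq)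
  then show ?thesis using trip_perm_eq[OF _ e(3)] e(4) by simp
qed

text \<open>A trip from \<open>B\<close> or \<open>C\<close> ends at the right end of an arc of the
  other letter or at the left end of an arc of its own, as the criterion decides, so its last letter
  is known. Exchanging the roles of the heights covers both letters.\<close>

lemma letter_at_trip_perm:
  assumes w: "kreweras n w" and i: "1 \<le> i" "i \<le> length w"
  shows "letter_at w (trip_perm w i) = emitted w i"
proof -
  let ?X = "height B w" and ?Y = "height C w" and ?N = "length w"
  interpret T: two_matchings ?X ?Y ?N w by (rule kreweras_two_matchings[OF w])
  interpret S: two_matchings ?Y ?X ?N w by (rule T.swapped)
  have fst_A: "letter_at w p = A" and snd_x: "letter_at w q = x"
    if "(p, q) \<in> height_arcs (height x w) ?N" "x \<in> {B, C}" for p q x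
    using noncrossing_height_arcs[OF w that(2)] that(1) unfolding noncrossing_matching_def by auto
  have emitted: "emitted w i = (if emits ?X ?Y 0 ?N i then B else if emits ?Y ?X 0 ?N i then C else A)"
    by (simp add: emitted_def)
  note h = letter_height[OF i]
  show ?thesis
  proof (cases "letter_at w i")
    case A
    obtain b where b: "(i, b) \<in> height_arcs ?X ?N" using T.E.arc_from_up[of i] h[of B] i A by auto
    obtain d where d: "(i, d) \<in> height_arcs ?Y ?N" using T.F.arc_from_up[of i] h[of C] i A by auto
    have "b \<noteq> d" using T.ends_distinct(2)[OF b d] .
    then consider "b < d" | "d < b" by linarith
    then show ?thesis
    proof cases
      case 1
      show ?thesis using T.trip_perm_from_up[OF b d 1 A] T.trip_from_up(2,3)[OF b d 1] snd_x[OF b] emitted by simp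
    next
      case 2
      show ?thesis using S.trip_perm_from_up[OF d b 2 A] S.trip_from_up(2,3)[OF d b 2] snd_x[OF d] emitted by simp
    qed
  next
    case B
    interpret D: trip_from_down ?X ?Y ?N w i
      by unfold_locales (use i h[of B] B in auto)
    show ?thesis using D.trip_perm_from_down D.not_emits_own fst_A[of _ _ B] snd_x[of _ _ C] emitted B by auto
  next
    case C
    interpret D: trip_from_down ?Y ?X ?N w i
      by unfold_locales (use i h[of C] C in auto)
    show ?thesis using D.trip_perm_from_down D.not_emits_own fst_A[of _ _ C] snd_x[of _ _ B] emitted C by auto
  qed
qed

theorem theorem4p12:
  fixes n :: nat and w :: "letter list"
  assumes "1 \<le> n" and "kreweras n w"
  shows "evac n w = map (\<lambda>i. letter_at w (trip_perm w i)) (rev [1..<Suc (3 * n)])"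
proof -
  have "length w = 3 * n" using assms(2) by (simp add: kreweras_def)
  then show ?thesis
    unfolding evac_emitted[OF assms(2,1)] using letter_at_trip_perm[OF assms(2)] by auto
qed

end
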